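(* Let $E$ be a complete connected Riemannian manifold with Riemannian metric (distance) $d$, let $T$ be a finite set, let $\mu$ be a probability measure on $E^T$ with regular conditional distributions $\mu_i(dx_i|x)$, $i\in T$, and let $C=(c_{ij})_{i,j\in T}$ be its $d$-Dobrushin interdependence matrix, with spectral radius $r_{\mathrm{sp}}(C)$. Assume that $\int_{E^T} d(x_i,y_i)^2\,d\mu(x)<+\infty$ for all $i\in T$ and for some fixed $y\in E^T$. Let $$\lambda_0:=\sup\left\{\lambda\ge0:\ \lambda\,\mu_i(f,f)\le\int_E|\nabla_if|^2\,d\mu_i\quad\forall x\in E^T,\ i\in T,\ f\in C_b^1(E^T)\right\}.$$ If $r_{\mathrm{sp}}(C)<1$ and $\lambda_0>0$, then $$\lambda_0(1-r_{\mathrm{sp}}(C))\,\mu(f,f)\le\mathbb{E}^\mu\sum_{i\in T}|\nabla_if|^2\qquad\forall f\in C_b^1(E^T),$$ that is, the best constant $\lambda_1(\mu,\nabla)$ in the Poincaré inequality $\lambda_1(\mu,\nabla)\,\mu(f,f)\le\mathbb{E}^\mu\sum_{i\in T}|\nabla_if|^2$ ($f\in C_b^1(E^T)$) satisfies $\lambda_1(\mu,\nabla)\ge\lambda_0(1-r_{\mathrm{sp}}(C))$.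
   Context: For each $i\in T$, $\mu_i(dx_i|x)$ is a given regular conditional distribution under $\mu$ of $x_i$ knowing $x_{T\setminus\{i\}}$ (a probability kernel, defined for every $x\in E^T$ and depending on $x$ only through $x_{T\setminus\{i\}}$). For a function $f$ on $E^T$, $\mu_i(f)(x)$ denotes the integral of $f$ in its $i$-th variable against $\mu_i(\cdot|x)$, the other coordinates of $x$ being fixed; $\mu_i(f,g)=\mu_i(fg)-\mu_i(f)\mu_i(g)$; $\mu(f,g)$ is the covariance under $\mu$. $\nabla_i$ is the Riemannian gradient acting on the $i$-th coordinate $x_i\in E$. $C_b^1(E^T)$ is the space of bounded $C^1$ functions with bounded first derivatives. If $\lambda_0=+\infty$, the convention $\infty\cdot0=0$ is used. $W_{1,d}(\nu_1,\nu_2)=\inf_\pi\iint d(x,y)\,\pi(dx,dy)$, infimum over couplings $\pi$ of $\nu_1,\nu_2$. The $d$-Dobrushin interdependence coefficients are $$c_{ij}:=\sup\left\{\frac{W_{1,d}(\mu_i(\cdot|x),\mu_i(\cdot|y))}{d(x_j,y_j)}:\ x,y\in E^T,\ x=y\text{ off }j,\ x_j\neq y_j\right\},\quad i,j\in T$$ (so $c_{ii}=0$), taken to be finite, as is implicit in speaking of the spectral radius of $C$. *)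

theory Defs
  imports
    "HOL-Probability.Probability"
    "Jordan_Normal_Form.Spectral_Radius"
begin

section \<open>Riemannian manifolds\<close>

text \<open>\<open>Ck_on k f S\<close> is \<open>C\<^sup>k\<close> regularity; it is meant for open \<open>S\<close> and a finite-dimensional
  domain type, where continuity of all directional derivatives amounts to continuity of the
  derivative.\<close>

primrec Ck_on ::
  "nat \<Rightarrow> ('a::real_normed_vector \<Rightarrow> 'c::real_normed_vector) \<Rightarrow> 'a set \<Rightarrow> bool" where
  "Ck_on 0 f S \<longleftrightarrow> continuous_on S f"
| "Ck_on (Suc k) f S \<longleftrightarrow> (\<forall>x\<in>S. f differentiable (at x)) \<and>
     (\<forall>v. Ck_on k (\<lambda>x. frechet_derivative f (at x) v) S)"

definition smooth_on ::
  "('a::real_normed_vector \<Rightarrow> 'c::real_normed_vector) \<Rightarrow> 'a set \<Rightarrow> bool" where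
  "smooth_on f S \<longleftrightarrow> (\<forall>k. Ck_on k f S)"

text \<open>A chart is a pair of its domain and its coordinate map.\<close>

type_synonym ('e, 'b) chart = "'e set \<times> ('e \<Rightarrow> 'b)"

abbreviation chart_inv :: "('e, 'b) chart \<Rightarrow> 'b \<Rightarrow> 'e" where
  "chart_inv c \<equiv> inv_into (fst c) (snd c)"

definition smooth_atlas ::
  "('e::topological_space, 'b::euclidean_space) chart set \<Rightarrow> bool" where
  "smooth_atlas A \<longleftrightarrow>
     (\<Union>c\<in>A. fst c) = UNIV \<and>
     (\<forall>c\<in>A. open (fst c) \<and> open (snd c ` fst c) \<and>
        homeomorphism (fst c) (snd c ` fst c) (snd c) (chart_inv c)) \<and>
     (\<forall>c\<in>A. \<forall>c'\<in>A. smooth_on (snd c' \<circ> chart_inv c) (snd c ` (fst c \<inter> fst c')))"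

text \<open>Tangent vectors at a point \<open>p\<close> are written in the coordinates of a chart \<open>c\<close> around \<open>p\<close>:
  \<open>g c p v w\<close> is the inner product of the tangent vectors with coordinates \<open>v\<close> and \<open>w\<close>.
  The last clause says that the coordinate expressions define one and the same tensor.\<close>

type_synonym ('e, 'b) metric_tensor = "('e, 'b) chart \<Rightarrow> 'e \<Rightarrow> 'b \<Rightarrow> 'b \<Rightarrow> real"

definition riemannian_metric ::
  "('e::topological_space, 'b::euclidean_space) chart set \<Rightarrow> ('e, 'b) metric_tensor \<Rightarrow> bool" where
  "riemannian_metric A g \<longleftrightarrow>
     (\<forall>c\<in>A. \<forall>p\<in>fst c. bilinear (g c p) \<and> (\<forall>v w. g c p v w = g c p w v) \<and>
        (\<forall>v. v \<noteq> 0 \<longrightarrow> g c p v v > 0)) \<and>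
     (\<forall>c\<in>A. \<forall>v w. smooth_on (\<lambda>z. g c (chart_inv c z) v w) (snd c ` fst c)) \<and>
     (\<forall>c\<in>A. \<forall>c'\<in>A. \<forall>p\<in>fst c \<inter> fst c'. \<forall>v w.
        g c p v w = g c' p
          (frechet_derivative (snd c' \<circ> chart_inv c) (at (snd c p)) v)
          (frechet_derivative (snd c' \<circ> chart_inv c) (at (snd c p)) w))"

text \<open>The choice of the chart is immaterial in the notions below: speed and gradient norm
  are invariant under change of charts.\<close>

definition chart_at :: "('e, 'b) chart set \<Rightarrow> 'e \<Rightarrow> ('e, 'b) chart" where
  "chart_at A p = (SOME c. c \<in> A \<and> p \<in> fst c)"

definition piecewise_C1_curve ::
  "('e::topological_space, 'b::euclidean_space) chart set \<Rightarrow> (real \<Rightarrow> 'e) \<Rightarrow> bool" where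
  "piecewise_C1_curve A \<gamma> \<longleftrightarrow> continuous_on {0..1} \<gamma> \<and>
     (\<exists>S. finite S \<and>
        (\<forall>c\<in>A. (snd c \<circ> \<gamma>) C1_differentiable_on {t \<in> {0..1} - S. \<gamma> t \<in> fst c}))"

definition speed ::
  "('e, 'b::euclidean_space) chart set \<Rightarrow> ('e, 'b) metric_tensor \<Rightarrow> (real \<Rightarrow> 'e) \<Rightarrow> real \<Rightarrow> real" where
  "speed A g \<gamma> t =
     (let c = chart_at A (\<gamma> t); v = vector_derivative (snd c \<circ> \<gamma>) (at t)
      in sqrt (g c (\<gamma> t) v v))"

definition curve_length ::
  "('e, 'b::euclidean_space) chart set \<Rightarrow> ('e, 'b) metric_tensor \<Rightarrow> (real \<Rightarrow> 'e) \<Rightarrow> ennreal" where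
  "curve_length A g \<gamma> = (\<integral>\<^sup>+ t\<in>{0..1}. ennreal (speed A g \<gamma> t) \<partial>lborel)"

definition riemannian_distance ::
  "('e::topological_space, 'b::euclidean_space) chart set \<Rightarrow> ('e, 'b) metric_tensor \<Rightarrow>
     'e \<Rightarrow> 'e \<Rightarrow> ennreal" where
  "riemannian_distance A g p q =
     (INF \<gamma> \<in> {\<gamma>. piecewise_C1_curve A \<gamma> \<and> \<gamma> 0 = p \<and> \<gamma> 1 = q}. curve_length A g \<gamma>)"

text \<open>The type class \<open>polish_space\<close> supplies metric completeness and second countability.  The
  distance of the type is required to be the Riemannian one.  That charts are homeomorphisms
  for the topology of \<open>dist\<close> is no restriction, since the Riemannian distance always induces
  the manifold topology.\<close>

definition complete_connected_riemannian_manifold ::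
  "('e::polish_space, 'b::euclidean_space) chart set \<Rightarrow> ('e, 'b) metric_tensor \<Rightarrow> bool" where
  "complete_connected_riemannian_manifold A g \<longleftrightarrow>
     smooth_atlas A \<and> riemannian_metric A g \<and> connected (UNIV :: 'e set) \<and>
     (\<forall>p q. ennreal (dist p q) = riemannian_distance A g p q)"

definition riemannian_gradient ::
  "('e, 'b::euclidean_space) chart \<Rightarrow> ('e, 'b) metric_tensor \<Rightarrow> ('e \<Rightarrow> real) \<Rightarrow> 'e \<Rightarrow> 'b" where
  "riemannian_gradient c g h p =
     (THE w. \<forall>v. g c p w v = frechet_derivative (h \<circ> chart_inv c) (at (snd c p)) v)"

definition grad_norm ::
  "('e, 'b::euclidean_space) chart set \<Rightarrow> ('e, 'b) metric_tensor \<Rightarrow> ('e \<Rightarrow> real) \<Rightarrow> 'e \<Rightarrow> real" where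
  "grad_norm A g h p =
     (let c = chart_at A p; w = riemannian_gradient c g h p in sqrt (g c p w w))"

section \<open>The product \<open>E\<^sup>T\<close>\<close>

text \<open>Points of the product are functions \<open>'i \<Rightarrow> 'e\<close> on a finite index type \<open>'i\<close>;
  \<open>partial_grad_norm A g i f x\<close> is \<open>|\<nabla>\<^sub>i f|(x)\<close>.\<close>

definition partial_grad_norm ::
  "('e, 'b::euclidean_space) chart set \<Rightarrow> ('e, 'b) metric_tensor \<Rightarrow> 'i \<Rightarrow>
     (('i \<Rightarrow> 'e) \<Rightarrow> real) \<Rightarrow> ('i \<Rightarrow> 'e) \<Rightarrow> real" where
  "partial_grad_norm A g i f x = grad_norm A g (\<lambda>z. f (x(i := z))) (x i)"

text \<open>\<open>C\<^sup>1\<close> regularity is tested in the charts of the product manifold, which are the products of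
  charts of the factors.\<close>

definition C1_product ::
  "('e, 'b::euclidean_space) chart set \<Rightarrow> (('i::finite \<Rightarrow> 'e) \<Rightarrow> real) \<Rightarrow> bool" where
  "C1_product A f \<longleftrightarrow>
     (\<forall>c :: 'i \<Rightarrow> ('e, 'b) chart. (\<forall>i. c i \<in> A) \<longrightarrow>
        Ck_on 1 (\<lambda>z :: ('b, 'i) Finite_Cartesian_Product.vec. f (\<lambda>i. chart_inv (c i) (vec_nth z i)))
          {z. \<forall>i. vec_nth z i \<in> snd (c i) ` fst (c i)})"

definition Cb1 ::
  "('e, 'b::euclidean_space) chart set \<Rightarrow> ('e, 'b) metric_tensor \<Rightarrow>
     (('i::finite \<Rightarrow> 'e) \<Rightarrow> real) set" where
  "Cb1 A g = {f. C1_product A f \<and> bounded (range f) \<and>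
     (\<forall>i. bounded (range (partial_grad_norm A g i f)))}"

section \<open>Conditional distributions\<close>

definition off_coordinate ::
  "('i \<Rightarrow> 'e::topological_space) measure \<Rightarrow> 'i \<Rightarrow> ('i \<Rightarrow> 'e) measure" where
  "off_coordinate M i =
     vimage_algebra (space M) (\<lambda>x. restrict x (- {i})) (\<Pi>\<^sub>M j\<in>- {i}. borel)"

text \<open>\<open>\<kappa> i x\<close> is \<open>\<mu>\<^sub>i(\<cdot>|x)\<close>, defined for every \<open>x\<close>.\<close>

definition regular_conditional_distributions ::
  "('i::finite \<Rightarrow> 'e::topological_space) measure \<Rightarrow> ('i \<Rightarrow> ('i \<Rightarrow> 'e) \<Rightarrow> 'e measure) \<Rightarrow> bool" where
  "regular_conditional_distributions M \<kappa> \<longleftrightarrow>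
     (\<forall>i. \<kappa> i \<in> (\<Pi>\<^sub>M j\<in>UNIV. borel) \<rightarrow>\<^sub>M prob_algebra borel \<and>
        (\<forall>x y. (\<forall>j. j \<noteq> i \<longrightarrow> x j = y j) \<longrightarrow> \<kappa> i x = \<kappa> i y) \<and>
        (\<forall>B\<in>sets borel. AE x in M.
           measure (\<kappa> i x) B = real_cond_exp M (off_coordinate M i) (\<lambda>y. indicator B (y i)) x))"

definition covar :: "'a measure \<Rightarrow> ('a \<Rightarrow> real) \<Rightarrow> ('a \<Rightarrow> real) \<Rightarrow> real" where
  "covar M f h = (\<integral>x. f x * h x \<partial>M) - (\<integral>x. f x \<partial>M) * (\<integral>x. h x \<partial>M)"

definition cond_int ::
  "('i \<Rightarrow> ('i \<Rightarrow> 'e) \<Rightarrow> 'e measure) \<Rightarrow> 'i \<Rightarrow> (('i \<Rightarrow> 'e) \<Rightarrow> real) \<Rightarrow> ('i \<Rightarrow> 'e) \<Rightarrow> real" where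
  "cond_int \<kappa> i f x = (\<integral>z. f (x(i := z)) \<partial>\<kappa> i x)"

definition cond_covar ::
  "('i \<Rightarrow> ('i \<Rightarrow> 'e) \<Rightarrow> 'e measure) \<Rightarrow> 'i \<Rightarrow> (('i \<Rightarrow> 'e) \<Rightarrow> real) \<Rightarrow> (('i \<Rightarrow> 'e) \<Rightarrow> real) \<Rightarrow>
     ('i \<Rightarrow> 'e) \<Rightarrow> real" where
  "cond_covar \<kappa> i f h x =
     cond_int \<kappa> i (\<lambda>y. f y * h y) x - cond_int \<kappa> i f x * cond_int \<kappa> i h x"

section \<open>Dobrushin interdependence matrix\<close>

definition couplings ::
  "'e::topological_space measure \<Rightarrow> 'e measure \<Rightarrow> ('e \<times> 'e) measure set" where
  "couplings \<nu>1 \<nu>2 = {\<pi>. sets \<pi> = sets (borel \<Otimes>\<^sub>M borel) \<and>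
     distr \<pi> borel fst = \<nu>1 \<and> distr \<pi> borel snd = \<nu>2}"

definition W1 :: "'e::metric_space measure \<Rightarrow> 'e measure \<Rightarrow> ennreal" where
  "W1 \<nu>1 \<nu>2 = (INF \<pi> \<in> couplings \<nu>1 \<nu>2. \<integral>\<^sup>+ p. ennreal (dist (fst p) (snd p)) \<partial>\<pi>)"

definition dobrushin_coeff ::
  "('i \<Rightarrow> ('i \<Rightarrow> 'e::metric_space) \<Rightarrow> 'e measure) \<Rightarrow> 'i \<Rightarrow> 'i \<Rightarrow> ennreal" where
  "dobrushin_coeff \<kappa> i j =
     (SUP (x, y) \<in> {(x, y). (\<forall>k. k \<noteq> j \<longrightarrow> x k = y k) \<and> x j \<noteq> y j}.
        W1 (\<kappa> i x) (\<kappa> i y) / ennreal (dist (x j) (y j)))"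

text \<open>Library matrices are indexed by initial segments of the naturals, so the index type is
  enumerated by \<open>from_nat_into UNIV\<close>, a bijection from \<open>{..<CARD('i)}\<close>; the spectral radius
  does not depend on the enumeration.  The coefficients are read as reals, which is meaningful
  only when they are finite.\<close>

definition dobrushin_matrix ::
  "('i::finite \<Rightarrow> ('i \<Rightarrow> 'e::metric_space) \<Rightarrow> 'e measure) \<Rightarrow> complex mat" where
  "dobrushin_matrix \<kappa> = mat CARD('i) CARD('i) (\<lambda>(k, l). complex_of_real
     (enn2real (dobrushin_coeff \<kappa> (from_nat_into UNIV k) (from_nat_into UNIV l))))"

section \<open>Poincare constants\<close>

definition lambda0 ::
  "('e, 'b::euclidean_space) chart set \<Rightarrow> ('e, 'b) metric_tensor \<Rightarrow>
     ('i::finite \<Rightarrow> ('i \<Rightarrow> 'e) \<Rightarrow> 'e measure) \<Rightarrow> ereal" where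
  "lambda0 A g \<kappa> = Sup (ereal ` {l. 0 \<le> l \<and> (\<forall>x. \<forall>i. \<forall>f\<in>Cb1 A g.
     l * cond_covar \<kappa> i f f x \<le> cond_int \<kappa> i (\<lambda>y. (partial_grad_norm A g i f y)\<^sup>2) x)})"

definition lambda1 ::
  "('e, 'b::euclidean_space) chart set \<Rightarrow> ('e, 'b) metric_tensor \<Rightarrow>
     ('i::finite \<Rightarrow> 'e) measure \<Rightarrow> ereal" where
  "lambda1 A g M = Sup (ereal ` {l. 0 \<le> l \<and> (\<forall>f\<in>Cb1 A g.
     l * covar M f f \<le> (\<integral>x. (\<Sum>i\<in>UNIV. (partial_grad_norm A g i f x)\<^sup>2) \<partial>M))})"

end

theory Submission
  imports Defs
begin

text \<open>Averaging the one-site resamplings, \<open>P = (\<mu>\<^sub>1 + \<dots> + \<mu>\<^sub>n) / n\<close> is self-adjoint in \<open>L\<^sup>2(\<mu>)\<close> and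
  \<open>n (\<mu>(f, f) - \<mu>(f, P f)) = \<Sum>\<^sub>i \<integral> \<mu>\<^sub>i(f, f) d\<mu>\<close>, so that everything reduces to a spectral gap
  \<open>(1 - r) / n\<close> for \<open>P\<close>, where \<open>r\<close> is the spectral radius of \<open>C\<close>. A function with bounded gradient is
  Lipschitz in each coordinate, and by Kantorovich duality \<open>P\<close> transforms the vector of coordinatewise
  Lipschitz constants by the matrix \<open>((n - 1) I + C\<^sup>T) / n\<close>, whose powers decay like \<open>s\<^sup>k\<close> for every
  \<open>s > (n - 1 + r) / n\<close>. By the second moment assumption \<open>Var (P\<^sup>k f) = O(s\<^sup>2\<^sup>k)\<close> for such \<open>f\<close>. As
  \<open>k \<mapsto> Var (P\<^sup>k f)\<close> is log-convex, an asymptotic rate is already a bound on the first step: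
  \<open>Var (P f) \<le> s\<^sup>2 Var f\<close>.\<close>

section \<open>Gradient bounds and Lipschitz functions\<close>

text \<open>Averaging the resamplings, rather than performing them one after another, makes the
  operator self-adjoint. This matters because contraction of Lipschitz constants controls the
  variance of the iterates only up to a factor depending on f and on the second moment;
  log-convexity, a consequence of self-adjointness, discards every such factor. The averaging slows
  the contraction by a factor n, which the identity for the conditional variances gives back: n (1 -
  (n - 1 + r) / n) = 1 - r. The strict inequality for s leaves room for Jordan blocks, whose powers
  can exceed those of the spectral radius by a polynomial factor; s decreases to its limit only at
  the end. A second obstacle is measurability: the gradient norm is defined through an arbitrary
  choice of charts, and the conditional inequalities behind \<open>lambda0\<close> can be integrated
  against \<mu> only once it is known to be measurable. Finally \<open>lambda0\<close> may be
  infinite, so the estimates are made for each real admissible constant and the supremum is taken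
  last.\<close>

lemma riesz_pos_def:
  fixes B :: "'b::euclidean_space \<Rightarrow> 'b \<Rightarrow> real"
  assumes B: "bilinear B" and pos: "\<And>v. v \<noteq> 0 \<Longrightarrow> B v v > 0" and L: "linear L"
  shows "\<exists>!w. \<forall>v. B w v = L v"
proof -
  \<comment> \<open>T w records the values of B w on the basis. Its injectivity is the uniqueness
    claim, and by dimension it yields existence.\<close>
  define T where "T w = (\<Sum>b\<in>Basis. B w b *\<^sub>R b)" for w
  have T: "linear T"
    unfolding T_def
    by (intro linearI) (simp_all add: bilinear_ladd[OF B] bilinear_lmul[OF B] scaleR_left_distrib
        sum.distrib scaleR_sum_right)
  have Tb: "inner (T w) b = B w b" if "b \<in> Basis" for w b
    unfolding T_def using that by (simp add: inner_sum_left inner_Basis if_distrib sum.delta cong: if_cong)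
  have lin: "linear (B w)" for w
    using B unfolding bilinear_def by blast
  have inj: "w = w'" if "\<forall>v. B w v = B w' v" for w w'
  proof (rule ccontr)
    assume "w \<noteq> w'"
    then have "B (w - w') (w - w') > 0" using pos by simp
    then show False using that by (simp add: bilinear_lsub[OF B])
  qed
  have "inj T"
  proof (rule injI)
    fix w w' assume "T w = T w'"
    then have "B w b = B w' b" if "b \<in> Basis" for b
      using Tb[OF that] by metis
    then have "B w = B w'"
      by (intro linear_eq_stdbasis lin)
    then show "w = w'" by (intro inj) simp
  qed
  then have "surj T" using T linear_injective_imp_surjective by blast
  then obtain w where w: "T w = (\<Sum>b\<in>Basis. L b *\<^sub>R b)" by (metis surj_def)
  have "B w b = L b" if "b \<in> Basis" for b
    using Tb[OF that, of w] that
    by (simp add: w inner_sum_left inner_Basis if_distrib sum.delta cong: if_cong)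
  then have "B w = L" by (intro linear_eq_stdbasis lin L)
  then show ?thesis using inj by (intro ex1I[of _ w]) auto
qed

lemma cauchy_schwarz_pos_def:
  fixes B :: "'b::real_vector \<Rightarrow> 'b \<Rightarrow> real"
  assumes B: "bilinear B" and sym: "\<And>v w. B v w = B w v" and pos: "\<And>v. v \<noteq> 0 \<Longrightarrow> B v v > 0"
  shows "\<bar>B w v\<bar> \<le> sqrt (B w w) * sqrt (B v v)"
proof (cases "v = 0")
  case True
  then show ?thesis by (simp add: bilinear_rzero[OF B])
next
  case False
  have nn: "B u u \<ge> 0" for u using pos[of u] by (cases "u = 0") (auto simp: bilinear_rzero[OF B])
  \<comment> \<open>This t minimises B (w - t v) (w - t v).\<close>
  define t where "t = B w v / B v v"
  have "0 \<le> B (w - t *\<^sub>R v) (w - t *\<^sub>R v)" by (rule nn)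
  also have "\<dots> = B w w - (B w v)\<^sup>2 / B v v"
    using pos[OF False] sym[of v w]
    by (simp add: bilinear_lsub[OF B] bilinear_rsub[OF B] bilinear_lmul[OF B] bilinear_rmul[OF B]
        t_def field_simps power2_eq_square)
  finally have "(B w v)\<^sup>2 \<le> B w w * B v v"
    using pos[OF False] by (simp add: field_simps)
  then have "sqrt ((B w v)\<^sup>2) \<le> sqrt (B w w * B v v)" by (rule real_sqrt_le_mono)
  then show ?thesis by (simp add: real_sqrt_mult)
qed

section \<open>Gradients in charts and their independence of the chart\<close>

definition chart_differentiable ::
  "('e, 'b::euclidean_space) chart set \<Rightarrow> ('e \<Rightarrow> real) \<Rightarrow> 'e \<Rightarrow> bool" where
  "chart_differentiable A h p \<longleftrightarrow>
     (\<forall>c\<in>A. p \<in> fst c \<longrightarrow> (h \<circ> chart_inv c) differentiable (at (snd c p)))"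

abbreviation chart_derivative ::
  "('e, 'b::euclidean_space) chart \<Rightarrow> ('e \<Rightarrow> real) \<Rightarrow> 'e \<Rightarrow> 'b \<Rightarrow> real" where
  "chart_derivative c h p \<equiv> frechet_derivative (h \<circ> chart_inv c) (at (snd c p))"

lemma smooth_atlas_chart:
  assumes "smooth_atlas A" "c \<in> A"
  shows "open (fst c)" "open (snd c ` fst c)" "inj_on (snd c) (fst c)"
    "continuous_on (fst c) (snd c)" "continuous_on (snd c ` fst c) (chart_inv c)"
    "p \<in> fst c \<Longrightarrow> chart_inv c (snd c p) = p"
    "z \<in> snd c ` fst c \<Longrightarrow> chart_inv c z \<in> fst c"
    "z \<in> snd c ` fst c \<Longrightarrow> snd c (chart_inv c z) = z"
proof -
  have h: "homeomorphism (fst c) (snd c ` fst c) (snd c) (chart_inv c)"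
    and o: "open (fst c)" "open (snd c ` fst c)"
    using assms unfolding smooth_atlas_def by blast+
  show "open (fst c)" "open (snd c ` fst c)" by fact+
  show "inj_on (snd c) (fst c)"
    using h by (metis homeomorphism_apply1 inj_on_inverseI)
  show "continuous_on (fst c) (snd c)" "continuous_on (snd c ` fst c) (chart_inv c)"
    "p \<in> fst c \<Longrightarrow> chart_inv c (snd c p) = p"
    using h by (auto simp: homeomorphism_def)
  show "z \<in> snd c ` fst c \<Longrightarrow> chart_inv c z \<in> fst c"
    "z \<in> snd c ` fst c \<Longrightarrow> snd c (chart_inv c z) = z"
    by (auto simp: f_inv_into_f inv_into_into)
qed

lemma chart_at_mem:
  assumes "smooth_atlas A"
  shows "chart_at A p \<in> A" "p \<in> fst (chart_at A p)"
proof -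
  have "\<exists>c. c \<in> A \<and> p \<in> fst c" using assms unfolding smooth_atlas_def by blast
  from someI_ex[OF this] show "chart_at A p \<in> A" "p \<in> fst (chart_at A p)"
    unfolding chart_at_def by auto
qed

lemma riemannian_metric_inner:
  assumes "riemannian_metric A g" "c \<in> A" "p \<in> fst c"
  shows "bilinear (g c p)" "g c p v w = g c p w v" "v \<noteq> 0 \<Longrightarrow> g c p v v > 0" "g c p v v \<ge> 0"
proof -
  show *: "bilinear (g c p)" "g c p v w = g c p w v" "v \<noteq> 0 \<Longrightarrow> g c p v v > 0"
    using assms unfolding riemannian_metric_def by blast+
  show "g c p v v \<ge> 0"
    using *(3) bilinear_rzero[OF *(1)] by (cases "v = 0") auto
qed

lemma riemannian_gradient:
  assumes "riemannian_metric A g" "c \<in> A" "p \<in> fst c"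
    and "(h \<circ> chart_inv c) differentiable (at (snd c p))"
  shows "g c p (riemannian_gradient c g h p) v = chart_derivative c h p v"
proof -
  have "\<exists>!w. \<forall>v. g c p w v = chart_derivative c h p v"
    by (intro riesz_pos_def riemannian_metric_inner[OF assms(1-3)] linear_frechet_derivative assms(4))
  from theI'[OF this] show ?thesis unfolding riemannian_gradient_def by blast
qed

lemma chart_transition:
  assumes A: "smooth_atlas A" and c: "c \<in> A" "p \<in> fst c" and c': "c' \<in> A" "p \<in> fst c'"
  shows "(snd c' \<circ> chart_inv c) differentiable (at (snd c p))"
    and "open (snd c ` (fst c \<inter> fst c'))"
proof -
  have "smooth_on (snd c' \<circ> chart_inv c) (snd c ` (fst c \<inter> fst c'))"
    using A c c' unfolding smooth_atlas_def by blast
  then have "Ck_on (Suc 0) (snd c' \<circ> chart_inv c) (snd c ` (fst c \<inter> fst c'))"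
    unfolding smooth_on_def by blast
  then show "(snd c' \<circ> chart_inv c) differentiable (at (snd c p))"
    using c c' by simp
  have "homeomorphism (fst c) (snd c ` fst c) (snd c) (chart_inv c)"
    using A c unfolding smooth_atlas_def by blast
  then have "openin (top_of_set (snd c ` fst c)) (snd c ` (fst c \<inter> fst c'))"
    using smooth_atlas_chart(1)[OF A c'(1)]
    by (intro homeomorphism_imp_open_map) auto
  then show "open (snd c ` (fst c \<inter> fst c'))"
    using smooth_atlas_chart(2)[OF A c(1)] openin_open_trans by blast
qed

lemma chart_derivative_change:
  assumes A: "smooth_atlas A" and c: "c \<in> A" "p \<in> fst c" and c': "c' \<in> A" "p \<in> fst c'"
    and h: "chart_differentiable A h p"
  shows "chart_derivative c h p v =
    chart_derivative c' h p (frechet_derivative (snd c' \<circ> chart_inv c) (at (snd c p)) v)"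
proof -
  let ?\<tau> = "snd c' \<circ> chart_inv c"
  note tr = chart_transition[OF A c c']
  have \<tau>p: "?\<tau> (snd c p) = snd c' p" using smooth_atlas_chart(6)[OF A] c by simp
  have d: "(h \<circ> chart_inv c') differentiable (at (?\<tau> (snd c p)))"
    using h c' unfolding \<tau>p chart_differentiable_def by blast
  have "chart_derivative c h p = frechet_derivative ((h \<circ> chart_inv c') \<circ> ?\<tau>) (at (snd c p))"
  \<comment> \<open>The two coordinate expressions of h agree on the overlap of the charts only;
    since its image is open, this determines the derivative.\<close>
  proof (rule frechet_derivative_transform_within_open[OF _ tr(2)])
    show "(h \<circ> chart_inv c) differentiable (at (snd c p))"
      using h c unfolding chart_differentiable_def by blast
    show "snd c p \<in> snd c ` (fst c \<inter> fst c')" using c c' by blast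
    show "(h \<circ> chart_inv c) x = (h \<circ> chart_inv c' \<circ> ?\<tau>) x" if "x \<in> snd c ` (fst c \<inter> fst c')" for x
      using that smooth_atlas_chart(6)[OF A c(1)] smooth_atlas_chart(6)[OF A c'(1)] by auto
  qed
  also have "\<dots> = chart_derivative c' h p \<circ> frechet_derivative ?\<tau> (at (snd c p))"
    unfolding frechet_derivative_compose[OF tr(1) d] \<tau>p ..
  finally show ?thesis by simp
qed

text \<open>The derivative J of the transition map is an isometry for the two coordinate forms of
  the metric, hence injective, hence surjective. It maps one gradient to the other because both
  represent the same differential. This permits replacing the chart chosen by
  \<open>chart_at\<close> by any other one.\<close>

lemma gradient_norm_chart_independent:
  assumes A: "smooth_atlas A" and g: "riemannian_metric A g"
    and c: "c \<in> A" "p \<in> fst c" and c': "c' \<in> A" "p \<in> fst c'"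
    and h: "chart_differentiable A h p"
  shows "g c p (riemannian_gradient c g h p) (riemannian_gradient c g h p) =
    g c' p (riemannian_gradient c' g h p) (riemannian_gradient c' g h p)"
proof -
  define J where "J = frechet_derivative (snd c' \<circ> chart_inv c) (at (snd c p))"
  define w where "w = riemannian_gradient c g h p"
  define w' where "w' = riemannian_gradient c' g h p"
  have J: "linear J" unfolding J_def
    by (intro linear_frechet_derivative chart_transition[OF A c c'])
  have tensor: "g c p v w = g c' p (J v) (J w)" for v w
    using g c c' unfolding riemannian_metric_def J_def by blast
  note i = riemannian_metric_inner[OF g c] and i' = riemannian_metric_inner[OF g c']
  have "inj J"
  proof (rule linear_injective_0[OF J, THEN iffD2], intro allI impI, rule ccontr)
    fix v assume "J v = 0" "v \<noteq> 0"
    then show False using tensor[of v v] i(3)[of v] bilinear_lzero[OF i'(1)] by simp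
  qed
  then have "surj J" using J linear_injective_imp_surjective by blast
  have eq: "g c' p (J w) (J v) = g c' p w' (J v)" for v
  proof -
    have "g c' p (J w) (J v) = chart_derivative c h p v"
      unfolding tensor[symmetric] w_def
      using h c by (intro riemannian_gradient[OF g c]) (auto simp: chart_differentiable_def)
    also have "\<dots> = chart_derivative c' h p (J v)"
      unfolding J_def by (rule chart_derivative_change[OF A c c' h])
    also have "\<dots> = g c' p w' (J v)"
      unfolding w'_def using h c'
      by (intro riemannian_gradient[OF g c', symmetric]) (auto simp: chart_differentiable_def)
    finally show ?thesis .
  qed
  \<comment> \<open>J w and w' are known to agree only when paired with vectors in the range of J;
    by surjectivity their own difference is such a vector.\<close>
  obtain u where u: "J w - w' = J u" using \<open>surj J\<close> by (metis surj_def)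
  have "g c' p (J w - w') (J w - w') = 0"
    using eq[of u] unfolding u[symmetric] bilinear_lsub[OF i'(1)] by simp
  then have "J w = w'" using i'(3)[of "J w - w'"] by auto
  then show ?thesis unfolding w_def[symmetric] w'_def[symmetric] by (simp add: tensor)
qed

lemma grad_norm_sqr:
  assumes A: "smooth_atlas A" and g: "riemannian_metric A g" and c: "c \<in> A" "p \<in> fst c"
    and h: "chart_differentiable A h p"
  shows "(grad_norm A g h p)\<^sup>2 = g c p (riemannian_gradient c g h p) (riemannian_gradient c g h p)"
  unfolding grad_norm_def Let_def
  using riemannian_metric_inner(4)[OF g chart_at_mem[OF A]]
    gradient_norm_chart_independent[OF A g c chart_at_mem[OF A] h] by simp

lemma grad_norm_nonneg:
  assumes "smooth_atlas A" "riemannian_metric A g"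
  shows "grad_norm A g h p \<ge> 0"
  unfolding grad_norm_def Let_def
  by (intro real_sqrt_ge_zero riemannian_metric_inner(4)[OF assms(2)] chart_at_mem[OF assms(1)])

lemma chart_derivative_bound:
  assumes A: "smooth_atlas A" and g: "riemannian_metric A g" and c: "c \<in> A" "p \<in> fst c"
    and h: "chart_differentiable A h p"
  shows "\<bar>chart_derivative c h p v\<bar> \<le> grad_norm A g h p * sqrt (g c p v v)"
proof -
  have d: "(h \<circ> chart_inv c) differentiable (at (snd c p))"
    using h c by (auto simp: chart_differentiable_def)
  have "grad_norm A g h p = sqrt (g c p (riemannian_gradient c g h p) (riemannian_gradient c g h p))"
    by (metis grad_norm_sqr[OF A g c h] grad_norm_nonneg[OF A g] real_sqrt_unique)
  then show ?thesis
    using cauchy_schwarz_pos_def[OF riemannian_metric_inner(1-3)[OF g c], of "riemannian_gradient c g h p" v]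
      riemannian_gradient[OF g c d, of v] by simp
qed

lemma chart_differentiable_isCont:
  fixes h :: "'e::t2_space \<Rightarrow> real"
  assumes A: "smooth_atlas A" and h: "chart_differentiable A h p"
  shows "isCont h p"
proof -
  define c where "c = chart_at A p"
  have c: "c \<in> A" "p \<in> fst c" unfolding c_def by (rule chart_at_mem[OF A])+
  note ch = smooth_atlas_chart[OF A c(1)]
  have "isCont (h \<circ> chart_inv c) (snd c p)"
    using h c unfolding chart_differentiable_def by (intro differentiable_imp_continuous_within) auto
  moreover have "isCont (snd c) p"
    using ch(1,4) c(2) continuous_on_eq_continuous_at by blast
  ultimately have "isCont ((h \<circ> chart_inv c) \<circ> snd c) p" by (rule continuous_at_compose[rotated])
  moreover have "\<forall>\<^sub>F x in nhds p. ((h \<circ> chart_inv c) \<circ> snd c) x = h x"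
    using ch(1) c(2) ch(6) by (auto simp: eventually_nhds)
  ultimately show ?thesis using isCont_cong by blast
qed

section \<open>Functions along curves, and the Lipschitz bound from curve lengths\<close>

lemma curve_has_vector_derivative:
  fixes \<gamma> :: "real \<Rightarrow> 'e::t2_space"
  assumes A: "smooth_atlas A" and c: "c \<in> A" "\<gamma> t \<in> fst c"
    and \<gamma>: "continuous_on {0<..<1} \<gamma>" and t: "t \<in> {0<..<1}"
    and d: "(snd c \<circ> \<gamma>) differentiable (at t)" and h: "chart_differentiable A h (\<gamma> t)"
  shows "(h \<circ> \<gamma> has_vector_derivative
    chart_derivative c h (\<gamma> t) (vector_derivative (snd c \<circ> \<gamma>) (at t))) (at t)"
proof -
  let ?v = "vector_derivative (snd c \<circ> \<gamma>) (at t)" and ?D = "chart_derivative c h (\<gamma> t)"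
  note ch = smooth_atlas_chart[OF A c(1)]
  have hd: "(h \<circ> chart_inv c) differentiable (at (snd c (\<gamma> t)))"
    using h c unfolding chart_differentiable_def by auto
  have lin: "linear ?D" by (rule linear_frechet_derivative[OF hd])
  have "((snd c \<circ> \<gamma>) has_derivative (\<lambda>s. s *\<^sub>R ?v)) (at t)"
    using d by (simp add: vector_derivative_works has_vector_derivative_def)
  moreover have "((h \<circ> chart_inv c) has_derivative ?D) (at ((snd c \<circ> \<gamma>) t))"
    using hd by (simp add: frechet_derivative_works)
  ultimately have "((h \<circ> chart_inv c) \<circ> (snd c \<circ> \<gamma>) has_derivative ?D \<circ> (\<lambda>s. s *\<^sub>R ?v)) (at t)"
    by (rule diff_chain_at)
  then have "((h \<circ> chart_inv c) \<circ> (snd c \<circ> \<gamma>) has_vector_derivative ?D ?v) (at t)"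
    unfolding has_vector_derivative_def
    by (rule has_derivative_eq_rhs) (simp add: fun_eq_iff linear_scale[OF lin])
  \<comment> \<open>The chart expression equals h along \<gamma> only while the curve stays in the
    chart, which continuity guarantees near t.\<close>
  moreover have "open ({0<..<1} \<inter> \<gamma> -` fst c)"
    by (intro continuous_open_preimage \<gamma> ch(1)) auto
  ultimately show ?thesis
    by (rule has_vector_derivative_transform_within_open) (use t c ch(6) in auto)
qed

text \<open>The speed is not known to be measurable, so \<open>K\<close> could not be pulled out of the upper bound
  \<open>\<integral>\<^sup>+ K * speed\<close>; hence the division by \<open>K\<close> on the left.\<close>

lemma curve_length_ge:
  fixes \<gamma> :: "real \<Rightarrow> 'e::t2_space"
  assumes A: "smooth_atlas A" and g: "riemannian_metric A g"
    and \<gamma>: "piecewise_C1_curve A \<gamma>"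
    and h: "\<And>p. chart_differentiable A h p" and K: "K > 0" "\<And>p. grad_norm A g h p \<le> K"
  shows "ennreal (\<bar>h (\<gamma> 1) - h (\<gamma> 0)\<bar> / K) \<le> curve_length A g \<gamma>"
proof (cases "curve_length A g \<gamma> < \<infinity>")
  case False
  then have "curve_length A g \<gamma> = \<infinity>" by (simp add: top.not_eq_extremum[symmetric] infinity_ennreal_def)
  then show ?thesis by simp
next
  case fin: True
  obtain S where cont: "continuous_on {0..1} \<gamma>" and S: "finite S"
    and C1: "\<And>c. c \<in> A \<Longrightarrow> (snd c \<circ> \<gamma>) C1_differentiable_on {t \<in> {0..1} - S. \<gamma> t \<in> fst c}"
    using \<gamma> unfolding piecewise_C1_curve_def by blast
  \<comment> \<open>The derivative of h along \<gamma>, computed in the very chart that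
    \<open>speed\<close> selects, so that the two can be compared pointwise. Endpoints and the
    exceptional set get the value 0.\<close>
  define F where "F t = (if t \<in> {0<..<1} - S then
    chart_derivative (chart_at A (\<gamma> t)) h (\<gamma> t) (vector_derivative (snd (chart_at A (\<gamma> t)) \<circ> \<gamma>) (at t))
    else 0)" for t
  have Fbound: "\<bar>F t\<bar> \<le> K * speed A g \<gamma> t" for t
  proof -
    let ?c = "chart_at A (\<gamma> t)"
    let ?v = "vector_derivative (snd ?c \<circ> \<gamma>) (at t)"
    note c = chart_at_mem[OF A, of "\<gamma> t"]
    have sp: "speed A g \<gamma> t = sqrt (g ?c (\<gamma> t) ?v ?v)"
      by (simp add: speed_def Let_def)
    have "\<bar>F t\<bar> \<le> grad_norm A g h (\<gamma> t) * speed A g \<gamma> t"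
      using chart_derivative_bound[OF A g c h, of ?v] grad_norm_nonneg[OF A g, of h "\<gamma> t"]
        riemannian_metric_inner(4)[OF g c, of ?v]
      by (auto simp: F_def sp)
    also have "\<dots> \<le> K * speed A g \<gamma> t"
      using K(2)[of "\<gamma> t"] riemannian_metric_inner(4)[OF g c, of ?v]
      by (intro mult_right_mono) (auto simp: sp)
    finally show ?thesis .
  qed
  have hcont: "continuous_on UNIV h"
    using chart_differentiable_isCont[OF A h] by (simp add: continuous_on_eq_continuous_at)
  have int: "(F has_integral ((h \<circ> \<gamma>) 1 - (h \<circ> \<gamma>) 0)) {0..1}"
  proof (rule fundamental_theorem_of_calculus_interior_strong[OF S])
    show "continuous_on {0..1} (h \<circ> \<gamma>)"
      by (intro continuous_on_compose cont continuous_on_subset[OF hcont]) auto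
    fix t :: real assume t: "t \<in> {0<..<1} - S"
    let ?c = "chart_at A (\<gamma> t)"
    note c = chart_at_mem[OF A, of "\<gamma> t"]
    have "(snd ?c \<circ> \<gamma>) differentiable (at t)"
      using C1[OF c(1)] t c(2) by (auto simp: C1_differentiable_on_eq)
    moreover have "continuous_on {0<..<1} \<gamma>"
      using cont by (rule continuous_on_subset) auto
    ultimately show "(h \<circ> \<gamma> has_vector_derivative F t) (at t)"
      using curve_has_vector_derivative[where \<gamma>=\<gamma> and t=t and h=h, OF A c] h t by (simp add: F_def)
  qed simp
  define G where "G t = indicator {0..1} t *\<^sub>R F t" for t :: real
  \<comment> \<open>\<open>chart_at\<close> makes measurability of F invisible in its definition; it
    follows from gauge integrability, which the fundamental theorem of calculus provides.\<close>
  have G: "G \<in> borel_measurable lebesgue"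
  proof -
    have "F \<in> borel_measurable (lebesgue_on {0..1})"
      using int by (intro integrable_imp_measurable) blast
    then show ?thesis
      unfolding G_def by (subst (asm) borel_measurable_restrict_space_iff) auto
  qed
  have le: "(\<integral>\<^sup>+t. ennreal (\<bar>G t\<bar> / K) \<partial>lebesgue) \<le> curve_length A g \<gamma>"
    unfolding curve_length_def nn_integral_completion
  proof (intro nn_integral_mono)
    fix t :: real
    have "\<bar>F t\<bar> / K \<le> speed A g \<gamma> t" using Fbound[of t] K by (simp add: field_simps)
    then show "ennreal (\<bar>G t\<bar> / K) \<le> ennreal (speed A g \<gamma> t) * indicator {0..1} t"
      by (auto simp: G_def indicator_def intro!: ennreal_leI)
  qed
  \<comment> \<open>Domination by the finite length upgrades gauge integrability to absolute
    integrability, so that the two integrals agree.\<close>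
  have GK: "integrable lebesgue (\<lambda>t. G t / K)"
    using G le fin K by (intro integrableI_bounded) (auto simp: abs_divide)
  then have "integrable lebesgue G"
    using integrable_mult_right[OF GK, of K] K by simp
  then have "(F has_integral (LINT t:{0..1}|lebesgue. F t)) {0..1}"
    by (intro has_integral_set_lebesgue) (simp add: set_integrable_def G_def[abs_def])
  then have "h (\<gamma> 1) - h (\<gamma> 0) = (LINT t|lebesgue. G t)"
    using has_integral_unique[OF int] by (simp add: set_lebesgue_integral_def G_def)
  then have "\<bar>h (\<gamma> 1) - h (\<gamma> 0)\<bar> / K = norm (LINT t|lebesgue. G t / K)"
    using K by (simp add: abs_divide)
  also have "ennreal \<dots> \<le> (\<integral>\<^sup>+t. norm (G t / K) \<partial>lebesgue)"
    by (rule integral_norm_bound_ennreal[OF GK])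
  also have "\<dots> \<le> curve_length A g \<gamma>" using le K by (simp add: abs_divide)
  finally show ?thesis .
qed

lemma grad_norm_bounded_imp_lipschitz:
  fixes A :: "('e::polish_space, 'b::euclidean_space) chart set"
  assumes M: "complete_connected_riemannian_manifold A g"
    and h: "\<And>p. chart_differentiable A h p" and K: "K > 0" "\<And>p. grad_norm A g h p \<le> K"
  shows "\<bar>h p - h q\<bar> \<le> K * dist p q"
proof -
  have A: "smooth_atlas A" and g: "riemannian_metric A g"
    and d: "ennreal (dist p q) = riemannian_distance A g p q"
    using M unfolding complete_connected_riemannian_manifold_def by auto
  have "ennreal (\<bar>h q - h p\<bar> / K) \<le> ennreal (dist p q)"
    unfolding d riemannian_distance_def
    using curve_length_ge[OF A g _ h K] by (intro INF_greatest) auto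
  then have "\<bar>h q - h p\<bar> / K \<le> dist p q" by simp
  then show ?thesis using K(1) by (simp add: field_simps abs_minus_commute)
qed

section \<open>From functions on the product to Lipschitz constants in each coordinate\<close>

lemma C1_product_chart_differentiable:
  fixes A :: "('e::topological_space, 'b::euclidean_space) chart set" and f :: "('i::finite \<Rightarrow> 'e) \<Rightarrow> real"
  assumes A: "smooth_atlas A" and f: "C1_product A f"
  shows "chart_differentiable A (\<lambda>z. f (x(i := z))) p"
  unfolding chart_differentiable_def
proof (intro ballI impI)
  fix c assume c: "c \<in> A" "p \<in> fst c"
  \<comment> \<open>c in slot i and a chart around x j in every other slot: in this product chart
    the slice is F composed with the affine map w, which freezes all coordinates but the
    i-th.\<close>
  define C where "C = (\<lambda>j. chart_at A (x j))(i := c)"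
  have CA: "C j \<in> A" for j using chart_at_mem[OF A] c by (simp add: C_def)
  define F where "F z = f (\<lambda>j. chart_inv (C j) (vec_nth z j))" for z
  define w where "w v = (\<chi> j. if j = i then v else snd (C j) (x j))" for v
  have "Ck_on 1 F {z. \<forall>j. vec_nth z j \<in> snd (C j) ` fst (C j)}"
    using f CA unfolding C1_product_def F_def by blast
  moreover have "w (snd c p) \<in> {z. \<forall>j. vec_nth z j \<in> snd (C j) ` fst (C j)}"
    using c chart_at_mem[OF A] by (auto simp: w_def C_def)
  ultimately have "F differentiable (at (w (snd c p)))" by (simp add: One_nat_def)
  moreover have "w differentiable (at (snd c p))"
  proof -
    have "w = (\<lambda>v. axis i v + (\<chi> j. if j = i then 0 else snd (C j) (x j)))"
      by (auto simp: w_def axis_def fun_eq_iff Finite_Cartesian_Product.vec_eq_iff)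
    moreover have "linear (axis i :: 'b \<Rightarrow> ('b, 'i) Finite_Cartesian_Product.vec)"
      by (intro linearI) (auto simp: axis_def Finite_Cartesian_Product.vec_eq_iff)
    ultimately show ?thesis
      by (simp only:) (intro differentiable_add differentiable_const linear_imp_differentiable)
  qed
  ultimately have "(F \<circ> w) differentiable (at (snd c p))" by (rule differentiable_chain_at[rotated])
  moreover have "F \<circ> w = (\<lambda>z. f (x(i := z))) \<circ> chart_inv c"
  proof
    fix v
    have "(\<lambda>j. chart_inv (C j) (vec_nth (w v) j)) = x(i := chart_inv c v)"
      using smooth_atlas_chart(6)[OF A] chart_at_mem[OF A] by (auto simp: w_def C_def)
    then show "(F \<circ> w) v = ((\<lambda>z. f (x(i := z))) \<circ> chart_inv c) v" by (simp add: F_def)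
  qed
  ultimately show "((\<lambda>z. f (x(i := z))) \<circ> chart_inv c) differentiable (at (snd c p))" by simp
qed

lemma Cb1_coordinate_lipschitz:
  fixes A :: "('e::polish_space, 'b::euclidean_space) chart set"
    and f :: "('i::finite \<Rightarrow> 'e) \<Rightarrow> real"
  assumes M: "complete_connected_riemannian_manifold A g" and f: "f \<in> Cb1 A g"
  obtains u where "\<And>i. u i \<ge> 0"
    "\<And>x i z z'. \<bar>f (x(i := z)) - f (x(i := z'))\<bar> \<le> u i * dist z z'"
proof -
  have A: "smooth_atlas A" using M unfolding complete_connected_riemannian_manifold_def by auto
  have C1: "C1_product A f" and b: "\<And>i. bounded (range (partial_grad_norm A g i f))"
    using f unfolding Cb1_def by auto
  obtain u where u: "\<And>i. u i > 0" "\<And>i x. \<bar>partial_grad_norm A g i f x\<bar> \<le> u i"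
  proof -
    have "\<exists>a. a > 0 \<and> (\<forall>x. \<bar>partial_grad_norm A g i f x\<bar> \<le> a)" for i
      using b[of i] unfolding bounded_pos by auto
    then show ?thesis using that by metis
  qed
  have "\<bar>f (x(i := z)) - f (x(i := z'))\<bar> \<le> u i * dist z z'" for x i z z'
  proof (rule grad_norm_bounded_imp_lipschitz[OF M C1_product_chart_differentiable[OF A C1] u(1)])
    fix p
    have "partial_grad_norm A g i f (x(i := p)) = grad_norm A g (\<lambda>z. f (x(i := z))) p"
      by (simp add: partial_grad_norm_def)
    then show "grad_norm A g (\<lambda>z. f (x(i := z))) p \<le> u i"
      using u(2)[of i "x(i := p)"] by simp
  qed
  with u(1) show ?thesis using that less_imp_le by metis
qed

section \<open>Measurability of the gradient norm\<close>

text \<open>One constant per coordinate, uniform in the remaining coordinates: resampling acts on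
  the vector u through the interdependence matrix, and a single Lipschitz constant would lose the
  spectral radius.\<close>

definition coord_lipschitz :: "('i \<Rightarrow> real) \<Rightarrow> (('i \<Rightarrow> 'e::metric_space) \<Rightarrow> real) \<Rightarrow> bool" where
  "coord_lipschitz u f \<longleftrightarrow>
     (\<forall>i x z z'. \<bar>f (x(i := z)) - f (x(i := z'))\<bar> \<le> u i * dist z z')"

text \<open>Move from y to x one coordinate at a time; the intermediate point takes its coordinates
  from x on S and from y elsewhere.\<close>

lemma coord_lipschitz_sum_bound:
  fixes f :: "('i::finite \<Rightarrow> 'e::metric_space) \<Rightarrow> real"
  assumes f: "coord_lipschitz u f"
  shows "\<bar>f x - f y\<bar> \<le> (\<Sum>i\<in>UNIV. u i * dist (x i) (y i))"
proof -
  have "\<bar>f (\<lambda>i. if i \<in> S then x i else y i) - f y\<bar> \<le> (\<Sum>i\<in>S. u i * dist (x i) (y i))" for S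
  proof (induction S rule: infinite_finite_induct)
    case (insert j S)
    let ?w = "\<lambda>i. if i \<in> S then x i else y i"
    have 1: "(\<lambda>i. if i \<in> insert j S then x i else y i) = ?w(j := x j)" and 2: "?w(j := y j) = ?w"
      using insert.hyps by auto
    have "\<bar>f (?w(j := x j)) - f (?w(j := y j))\<bar> \<le> u j * dist (x j) (y j)"
      using f unfolding coord_lipschitz_def by blast
    then have "\<bar>f (?w(j := x j)) - f y\<bar> \<le> u j * dist (x j) (y j) + (\<Sum>i\<in>S. u i * dist (x i) (y i))"
      using insert.IH unfolding 2 by linarith
    then show ?case using insert.hyps unfolding 1 by simp
  qed auto
  from this[of UNIV] show ?thesis by simp
qed

text \<open>Continuity is for the product topology on functions. It is the source of measurability
  of functions in \<open>Cb1\<close>, whose definition speaks of charts only.\<close>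

lemma coord_lipschitz_continuous:
  fixes f :: "('i::finite \<Rightarrow> 'e::metric_space) \<Rightarrow> real"
  assumes f: "coord_lipschitz u f"
  shows "continuous_on UNIV f"
proof (rule continuous_at_imp_continuous_on, intro ballI)
  fix x :: "'i \<Rightarrow> 'e"
  have "((\<lambda>y. \<Sum>i\<in>UNIV. u i * dist (y i) (x i)) \<longlongrightarrow> (\<Sum>i\<in>UNIV. u i * dist (x i) (x i))) (at x)"
  proof (intro tendsto_intros)
    fix i :: 'i
    have "continuous_on UNIV (\<lambda>y::'i \<Rightarrow> 'e. y i)" by (rule continuous_on_product_coordinates)
    then show "((\<lambda>y. y i) \<longlongrightarrow> x i) (at x)" by (simp add: continuous_on_def)
  qed
  then have "((\<lambda>y. \<Sum>i\<in>UNIV. u i * dist (y i) (x i)) \<longlongrightarrow> 0) (at x)" by simp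
  then have "((\<lambda>y. f y - f x) \<longlongrightarrow> 0) (at x)"
    by (rule Lim_null_comparison[rotated]) (simp add: coord_lipschitz_sum_bound[OF f])
  then show "isCont f x" by (simp add: isCont_def LIM_zero_iff)
qed

text \<open>Joint measurability in x and z is what makes resampling a Markov kernel: the base point
  and the new coordinate vary together.\<close>

lemma fun_upd_measurable:
  "(\<lambda>(x, z). x(i := z)) \<in> (\<Pi>\<^sub>M j\<in>UNIV. M j) \<Otimes>\<^sub>M M i \<rightarrow>\<^sub>M (\<Pi>\<^sub>M j\<in>UNIV. M j)"
proof -
  have "(\<lambda>p j. if j = i then snd p else fst p j) \<in> (\<Pi>\<^sub>M j\<in>UNIV. M j) \<Otimes>\<^sub>M M i \<rightarrow>\<^sub>M (\<Pi>\<^sub>M j\<in>UNIV. M j)"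
  proof (rule measurable_PiM_single')
    fix j
    have "(\<lambda>p. fst p j) \<in> (\<Pi>\<^sub>M j\<in>UNIV. M j) \<Otimes>\<^sub>M M i \<rightarrow>\<^sub>M M j"
      by (rule measurable_compose[OF measurable_fst measurable_component_singleton]) simp
    then show "(\<lambda>p. if j = i then snd p else fst p j) \<in> (\<Pi>\<^sub>M j\<in>UNIV. M j) \<Otimes>\<^sub>M M i \<rightarrow>\<^sub>M M j"
      by (cases "j = i") simp_all
  qed (auto simp: space_PiM PiE_iff space_pair_measure)
  also have "(\<lambda>p j. if j = i then snd p else fst p j) = (\<lambda>(x, z). x(i := z))"
    by (auto simp: fun_eq_iff)
  finally show ?thesis .
qed

text \<open>Completing the square, \<open>|w|\<^sup>2 = sup\<^sub>v (2 \<langle>w, v\<rangle> - |v|\<^sup>2)\<close>. With \<open>v\<close> in a countable dense set this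
  makes the gradient norm measurable although \<open>chart_at\<close> need not depend measurably on the point.\<close>

lemma grad_norm_sqr_gt_iff:
  assumes A: "smooth_atlas A" and g: "riemannian_metric A g" and c: "c \<in> A" "p \<in> fst c"
    and h: "chart_differentiable A h p"
    and D: "\<And>X. open X \<Longrightarrow> X \<noteq> {} \<Longrightarrow> \<exists>v\<in>D. v \<in> X"
  shows "a < (grad_norm A g h p)\<^sup>2 \<longleftrightarrow> (\<exists>v\<in>D. a < 2 * chart_derivative c h p v - g c p v v)"
proof -
  define w where "w = riemannian_gradient c g h p"
  note i = riemannian_metric_inner[OF g c]
  have d: "(h \<circ> chart_inv c) differentiable (at (snd c p))"
    using h c by (auto simp: chart_differentiable_def)
  have n: "(grad_norm A g h p)\<^sup>2 = g c p w w" unfolding w_def by (rule grad_norm_sqr[OF A g c h])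
  have e: "chart_derivative c h p v = g c p w v" for v
    unfolding w_def by (rule riemannian_gradient[OF g c d, symmetric])
  have square: "2 * g c p w v - g c p v v = g c p w w - g c p (w - v) (w - v)" for v
    using i(2)[of w v] by (simp add: bilinear_lsub[OF i(1)] bilinear_rsub[OF i(1)])
  show ?thesis
    unfolding n e
  proof
    assume a: "a < g c p w w"
    interpret bounded_bilinear "g c p"
      using i(1) by (simp add: bilinear_conv_bounded_bilinear)
    have "open {v. a < 2 * g c p w v - g c p v v}"
      by (intro open_Collect_less continuous_intros continuous_on)
    moreover have "w \<in> {v. a < 2 * g c p w v - g c p v v}" using a by simp
    ultimately show "\<exists>v\<in>D. a < 2 * g c p w v - g c p v v" using D by blast
  next
    assume "\<exists>v\<in>D. a < 2 * g c p w v - g c p v v"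
    then obtain v where "a < g c p w w - g c p (w - v) (w - v)" unfolding square by blast
    then show "a < g c p w w" using i(4)[of "w - v"] by simp
  qed
qed

lemma metric_tensor_measurable:
  fixes A :: "('e::topological_space, 'b::euclidean_space) chart set"
  assumes A: "smooth_atlas A" and g: "riemannian_metric A g" and c: "c \<in> A"
  shows "(\<lambda>p. if p \<in> fst c then g c p v v else 0) \<in> borel_measurable borel"
proof (rule borel_measurable_continuous_on_if)
  note ch = smooth_atlas_chart[OF A c]
  have "smooth_on (\<lambda>z. g c (chart_inv c z) v v) (snd c ` fst c)"
    using g c unfolding riemannian_metric_def by blast
  then have "Ck_on 0 (\<lambda>z. g c (chart_inv c z) v v) (snd c ` fst c)"
    unfolding smooth_on_def by blast
  then have "continuous_on (fst c) ((\<lambda>z. g c (chart_inv c z) v v) \<circ> snd c)"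
    by (intro continuous_on_compose ch(4)) simp
  then show "continuous_on (fst c) (\<lambda>p. g c p v v)"
    by (rule continuous_on_eq) (simp add: ch(6))
  show "fst c \<in> sets borel" using ch(1) by simp
qed simp

lemma difference_quotient_LIMSEQ:
  fixes F :: "'b::real_normed_vector \<Rightarrow> real"
  assumes "F differentiable (at z)"
  shows "(\<lambda>n. real (Suc n) * (F (z + inverse (real (Suc n)) *\<^sub>R v) - F z))
    \<longlonglongrightarrow> frechet_derivative F (at z) v"
proof -
  let ?D = "frechet_derivative F (at z)"
  have D: "(F has_derivative ?D) (at z)" using assms by (simp add: frechet_derivative_works)
  have lin: "linear ?D" by (rule linear_frechet_derivative[OF assms])
  have "((\<lambda>t. z + t *\<^sub>R v) has_derivative (\<lambda>t. t *\<^sub>R v)) (at 0)"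
    by (auto intro!: derivative_eq_intros)
  moreover have "(F has_derivative ?D) (at (z + 0 *\<^sub>R v))" using D by simp
  ultimately have "(F \<circ> (\<lambda>t. z + t *\<^sub>R v) has_derivative ?D \<circ> (\<lambda>t. t *\<^sub>R v)) (at 0)"
    by (rule diff_chain_at)
  then have "((\<lambda>t. F (z + t *\<^sub>R v)) has_derivative (\<lambda>t. t * ?D v)) (at 0)"
    by (simp add: o_def linear_scale[OF lin])
  then have "DERIV (\<lambda>t. F (z + t *\<^sub>R v)) 0 :> ?D v"
    by (simp add: has_field_derivative_def mult.commute[of _ "?D v"])
  then have "((\<lambda>t. (F (z + t *\<^sub>R v) - F z) / t) \<longlongrightarrow> ?D v) (at 0)"
    by (simp add: DERIV_def)
  moreover have "filterlim (\<lambda>n. inverse (real (Suc n))) (at 0) sequentially"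
    unfolding filterlim_at using LIMSEQ_inverse_real_of_nat by auto
  ultimately have "(\<lambda>n. (F (z + inverse (real (Suc n)) *\<^sub>R v) - F z) / inverse (real (Suc n))) \<longlonglongrightarrow> ?D v"
    by (rule filterlim_compose)
  then show ?thesis by (simp add: divide_inverse mult.commute)
qed

text \<open>A pointwise limit of difference quotients in the fixed direction v, with step 1 / (n +
  1). Fixing one chart avoids the choice hidden in \<open>chart_at\<close>.\<close>

lemma chart_derivative_measurable:
  fixes A :: "('e::polish_space, 'b::euclidean_space) chart set"
    and f :: "('i::finite \<Rightarrow> 'e) \<Rightarrow> real"
  assumes A: "smooth_atlas A" and c: "c \<in> A"
    and f: "f \<in> borel_measurable (\<Pi>\<^sub>M i\<in>UNIV. borel)"
    and d: "\<And>x p. chart_differentiable A (\<lambda>z. f (x(i := z))) p"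
  shows "(\<lambda>x. if x i \<in> fst c then chart_derivative c (\<lambda>z. f (x(i := z))) (x i) v else 0)
    \<in> borel_measurable (\<Pi>\<^sub>M i\<in>UNIV. borel)"
proof (rule borel_measurable_LIMSEQ_real)
  note ch = smooth_atlas_chart[OF A c]
  define t where "t n = inverse (real (Suc n))" for n
  define U where "U n = fst c \<inter> (\<lambda>p. snd c p + t n *\<^sub>R v) -` (snd c ` fst c)" for n
  \<comment> \<open>The shifted coordinates can leave the image of the chart. Then \<psi> n returns
    p itself, so that the quotient is 0 and \<psi> n stays Borel. For a fixed point of the chart
    this happens for finitely many n only, because the image is open.\<close>
  define \<psi> where "\<psi> n p = (if p \<in> U n then chart_inv c (snd c p + t n *\<^sub>R v) else p)" for n p
  have shift: "continuous_on (fst c) (\<lambda>p. snd c p + t n *\<^sub>R v)" for n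
    by (intro continuous_intros ch(4))
  have \<psi>: "\<psi> n \<in> borel \<rightarrow>\<^sub>M borel" for n
    unfolding \<psi>_def
  proof (rule borel_measurable_continuous_on_if)
    have "open (U n)" unfolding U_def by (rule continuous_open_preimage[OF shift ch(1,2)])
    then show "U n \<in> sets borel" by simp
    have "continuous_on (U n) (chart_inv c \<circ> (\<lambda>p. snd c p + t n *\<^sub>R v))"
    proof (rule continuous_on_compose)
      show "continuous_on (U n) (\<lambda>p. snd c p + t n *\<^sub>R v)"
        by (rule continuous_on_subset[OF shift]) (auto simp: U_def)
      show "continuous_on ((\<lambda>p. snd c p + t n *\<^sub>R v) ` U n) (chart_inv c)"
        by (rule continuous_on_subset[OF ch(5)]) (auto simp: U_def)
    qed
    then show "continuous_on (U n) (\<lambda>p. chart_inv c (snd c p + t n *\<^sub>R v))" by (simp add: o_def)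
  qed (rule continuous_on_id)
  define q where "q n x = real (Suc n) * (f (x(i := \<psi> n (x i))) - f x)" for n x
  let ?P = "\<Pi>\<^sub>M i\<in>(UNIV :: 'i set). borel :: 'e measure"
  show "(\<lambda>x. if x i \<in> fst c then q n x else 0) \<in> borel_measurable ?P" for n
  proof -
    have coord: "(\<lambda>x. x i) \<in> ?P \<rightarrow>\<^sub>M borel" by (rule measurable_component_singleton) simp
    have "(\<lambda>x. (x, \<psi> n (x i))) \<in> ?P \<rightarrow>\<^sub>M ?P \<Otimes>\<^sub>M borel"
      by (intro measurable_Pair measurable_ident_sets refl measurable_compose[OF coord \<psi>])
    from measurable_compose[OF this fun_upd_measurable[of i "\<lambda>_. borel"]]
    have "(\<lambda>x. x(i := \<psi> n (x i))) \<in> ?P \<rightarrow>\<^sub>M ?P" by simp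
    from measurable_compose[OF this f] have "q n \<in> borel_measurable ?P"
      unfolding q_def[abs_def] using f by (intro borel_measurable_times borel_measurable_diff) simp_all
    moreover have "{x \<in> space ?P. x i \<in> fst c} \<in> sets ?P"
      using measurable_sets[OF coord, of "fst c"] ch(1)
      by (simp add: vimage_def Int_def conj_commute)
    ultimately show ?thesis by (intro measurable_If) simp_all
  qed
  fix x :: "'i \<Rightarrow> 'e"
  show "(\<lambda>n. if x i \<in> fst c then q n x else 0) \<longlonglongrightarrow>
    (if x i \<in> fst c then chart_derivative c (\<lambda>z. f (x(i := z))) (x i) v else 0)"
  proof (cases "x i \<in> fst c")
    case True
    let ?F = "(\<lambda>z. f (x(i := z))) \<circ> chart_inv c"
    let ?z = "snd c (x i)"
    have "?F differentiable (at ?z)" using d[of x "x i"] c True by (auto simp: chart_differentiable_def)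
    from difference_quotient_LIMSEQ[OF this, of v]
    have lim: "(\<lambda>n. real (Suc n) * (?F (?z + t n *\<^sub>R v) - ?F ?z)) \<longlonglongrightarrow>
      chart_derivative c (\<lambda>z. f (x(i := z))) (x i) v" by (simp only: t_def)
    have "(\<lambda>n. ?z + t n *\<^sub>R v) \<longlonglongrightarrow> ?z + 0 *\<^sub>R v"
      unfolding t_def by (intro tendsto_intros LIMSEQ_inverse_real_of_nat)
    then have "(\<lambda>n. ?z + t n *\<^sub>R v) \<longlonglongrightarrow> ?z" by simp
    then have "eventually (\<lambda>n. ?z + t n *\<^sub>R v \<in> snd c ` fst c) sequentially"
      using ch(2) True by (auto intro: topological_tendstoD)
    then have "eventually (\<lambda>n. real (Suc n) * (?F (?z + t n *\<^sub>R v) - ?F ?z) = q n x) sequentially"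
    proof eventually_elim
      case (elim n)
      then have "x i \<in> U n" using True by (simp add: U_def)
      then show ?case using True ch(6) by (simp add: q_def \<psi>_def)
    qed
    then have "(\<lambda>n. q n x) \<longlonglongrightarrow> chart_derivative c (\<lambda>z. f (x(i := z))) (x i) v"
      using lim by (rule Lim_transform_eventually[rotated])
    then show ?thesis using True by simp
  qed simp
qed

text \<open>The atlas may be uncountable; Lindelof's theorem extracts countably many charts that
  still cover. Together with a countable dense set of directions this writes each superlevel set as
  a countable union of measurable sets.\<close>

lemma partial_grad_norm_sqr_measurable:
  fixes A :: "('e::polish_space, 'b::euclidean_space) chart set"
    and f :: "('i::finite \<Rightarrow> 'e) \<Rightarrow> real"
  assumes A: "smooth_atlas A" and g: "riemannian_metric A g"
    and f: "f \<in> borel_measurable (\<Pi>\<^sub>M i\<in>UNIV. borel)"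
    and d: "\<And>x p. chart_differentiable A (\<lambda>z. f (x(i := z))) p"
  shows "(\<lambda>x. (partial_grad_norm A g i f x)\<^sup>2) \<in> borel_measurable (\<Pi>\<^sub>M i\<in>UNIV. borel)"
    (is "_ \<in> borel_measurable ?P")
proof (rule borel_measurable_iff_greater[THEN iffD2], rule allI)
  fix a :: real
  obtain F where F: "F \<subseteq> fst ` A" "countable F" "\<Union>F = \<Union>(fst ` A)"
  proof (rule Lindelof)
    show "open S" if "S \<in> fst ` A" for S using that smooth_atlas_chart(1)[OF A] by auto
  qed
  define C where "C = inv_into A fst ` F"
  have C: "countable C" "C \<subseteq> A" "F = fst ` C"
    unfolding C_def using F(1,2) image_inv_into_cancel[OF refl F(1)] subsetD[OF F(1), THEN inv_into_into]
    by (simp_all add: image_subset_iff)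
  have cover: "\<exists>c\<in>C. p \<in> fst c" for p
  proof -
    have "\<Union>(fst ` A) = UNIV" using A by (simp add: smooth_atlas_def)
    then have "p \<in> \<Union>(fst ` C)" using F(3) C(3) by simp
    then show ?thesis by simp
  qed
  obtain D :: "'b set" where D: "countable D" "\<And>X. open X \<Longrightarrow> X \<noteq> {} \<Longrightarrow> \<exists>v\<in>D. v \<in> X"
    by (rule countable_dense_setE) blast
  \<comment> \<open>The value 0 off the chart makes both terms measurable on the whole product; the
    membership test in the equivalence below keeps these filler values out.\<close>
  define \<Phi> where "\<Phi> c v x =
    2 * (if x i \<in> fst c then chart_derivative c (\<lambda>z. f (x(i := z))) (x i) v else 0)
      - (if x i \<in> fst c then g c (x i) v v else 0)" for c v x
  have coord: "(\<lambda>x. x i) \<in> ?P \<rightarrow>\<^sub>M borel" by (rule measurable_component_singleton) simp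
  have "a < (partial_grad_norm A g i f x)\<^sup>2 \<longleftrightarrow> (\<exists>c\<in>C. \<exists>v\<in>D. x i \<in> fst c \<and> a < \<Phi> c v x)" for x
  proof -
    have "a < (partial_grad_norm A g i f x)\<^sup>2 \<longleftrightarrow> (\<exists>v\<in>D. a < \<Phi> c v x)"
      if "c \<in> C" "x i \<in> fst c" for c
      using grad_norm_sqr_gt_iff[OF A g _ that(2) d D(2), of a] that C(2)
      by (auto simp: \<Phi>_def partial_grad_norm_def)
    then show ?thesis using cover[of "x i"] by blast
  qed
  then have "{x \<in> space ?P. a < (partial_grad_norm A g i f x)\<^sup>2} =
    (\<Union>c\<in>C. \<Union>v\<in>D. {x \<in> space ?P. x i \<in> fst c} \<inter> {x \<in> space ?P. a < \<Phi> c v x})" by auto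
  also have "\<dots> \<in> sets ?P"
  proof (intro sets.countable_UN'' C(1) D(1) sets.Int)
    fix c v assume "c \<in> C" "v \<in> D"
    then have c: "c \<in> A" using C by blast
    show "{x \<in> space ?P. x i \<in> fst c} \<in> sets ?P"
      using measurable_sets[OF coord, of "fst c"] smooth_atlas_chart(1)[OF A c]
      by (simp add: vimage_def Int_def conj_commute)
    have "\<Phi> c v \<in> borel_measurable ?P"
      unfolding \<Phi>_def[abs_def]
      by (intro borel_measurable_diff borel_measurable_times borel_measurable_const
          chart_derivative_measurable[OF A c f d]
          measurable_compose[OF coord metric_tensor_measurable[OF A g c]])
    then show "{x \<in> space ?P. a < \<Phi> c v x} \<in> sets ?P"
      by (simp add: borel_measurable_iff_greater)
  qed
  finally show "{x \<in> space ?P. a < (partial_grad_norm A g i f x)\<^sup>2} \<in> sets ?P" .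
qed

section \<open>Resampling one coordinate\<close>

locale gibbs = prob_space \<mu>
  for \<mu> :: "('i::finite \<Rightarrow> 'e::polish_space) measure" +
  fixes \<kappa> :: "'i \<Rightarrow> ('i \<Rightarrow> 'e) \<Rightarrow> 'e measure"
  assumes sets_mu: "sets \<mu> = sets (\<Pi>\<^sub>M i\<in>UNIV. borel)"
    and rcd: "regular_conditional_distributions \<mu> \<kappa>"
begin

text \<open>Here \<open>P\<close> is the product sigma-algebra. The averaged operator called P in
  the overview is \<open>gibbs_step\<close>.\<close>

abbreviation P :: "('i \<Rightarrow> 'e) measure" where "P \<equiv> \<Pi>\<^sub>M i\<in>UNIV. borel"

text \<open>A class stable under resampling, in which all integrals exist. Smoothness would not
  survive: the kernels are not assumed to depend smoothly on x.\<close>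

definition bm :: "(('i \<Rightarrow> 'e) \<Rightarrow> real) set" where
  "bm = {f \<in> borel_measurable P. \<exists>K. \<forall>x. \<bar>f x\<bar> \<le> K}"

lemma space_mu [simp]: "space \<mu> = UNIV"
  using sets_eq_imp_space_eq[OF sets_mu] by (simp add: space_PiM)

lemma prob_UNIV [simp]: "prob UNIV = 1"
  using prob_space by simp

lemma measurable_mu [simp]: "measurable \<mu> N = measurable P N"
  by (intro measurable_cong_sets sets_mu refl)

lemma kernel_measurable: "\<kappa> i \<in> P \<rightarrow>\<^sub>M prob_algebra borel"
  and kernel_cong: "(\<And>j. j \<noteq> i \<Longrightarrow> x j = y j) \<Longrightarrow> \<kappa> i x = \<kappa> i y"
  and kernel_cond_exp: "B \<in> sets borel \<Longrightarrow> AE x in \<mu>. measure (\<kappa> i x) B =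
    real_cond_exp \<mu> (off_coordinate \<mu> i) (\<lambda>y. indicator B (y i)) x"
  using rcd unfolding regular_conditional_distributions_def by blast+

lemma kernel_prob: "prob_space (\<kappa> i x)" and kernel_sets: "sets (\<kappa> i x) = sets borel"
proof -
  have "\<kappa> i x \<in> space (prob_algebra borel)"
    by (rule measurable_space[OF kernel_measurable]) (simp add: space_PiM)
  then show "prob_space (\<kappa> i x)" "sets (\<kappa> i x) = sets borel" by (auto simp: space_prob_algebra)
qed

lemma kernel_space [simp]: "space (\<kappa> i x) = UNIV"
  using sets_eq_imp_space_eq[OF kernel_sets] by simp

lemma kernel_borel_measurable [simp]: "measurable (\<kappa> i x) N = measurable borel N"
  by (intro measurable_cong_sets kernel_sets refl)

text \<open>One update of the Gibbs sampler, lifted from a law on E to a Markov kernel on the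
  product; \<open>cond_int\<close> is integration against it.\<close>

definition resample :: "'i \<Rightarrow> ('i \<Rightarrow> 'e) \<Rightarrow> ('i \<Rightarrow> 'e) measure" where
  "resample i x = distr (\<kappa> i x) P (\<lambda>z. x(i := z))"

lemma resample_measurable: "resample i \<in> P \<rightarrow>\<^sub>M prob_algebra P"
  unfolding resample_def
  by (intro measurable_distr_prob_space2[where M=borel] kernel_measurable fun_upd_measurable)

lemma fun_upd_slice_measurable: "(\<lambda>z. x(i := z)) \<in> borel \<rightarrow>\<^sub>M P"
  using measurable_compose[OF measurable_Pair1'[of x P borel] fun_upd_measurable[of i "\<lambda>_. borel"]]
  by (simp add: space_PiM)

lemma integral_resample:
  "f \<in> borel_measurable P \<Longrightarrow> (\<integral>y. f y \<partial>resample i x) = cond_int \<kappa> i f x"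
  unfolding resample_def cond_int_def
  by (intro integral_distr) (simp_all add: fun_upd_slice_measurable)

lemma off_coordinate_subalgebra: "finite_measure_subalgebra \<mu> (off_coordinate \<mu> i)"
proof
  have "(\<lambda>x. restrict x (- {i})) \<in> P \<rightarrow>\<^sub>M (\<Pi>\<^sub>M j\<in>- {i}. borel)"
    by (rule measurable_restrict_subset) auto
  then have "sets (off_coordinate \<mu> i) \<subseteq> sets \<mu>"
    unfolding off_coordinate_def by (intro sets_image_in_sets) simp_all
  then show "subalgebra \<mu> (off_coordinate \<mu> i)"
    by (simp add: subalgebra_def off_coordinate_def)
qed

text \<open>The conditional distributions are given event by event, with a null set depending on the
  event, so the measures are compared on rectangles, which determine them. A rectangle splits into a
  condition ?D on the coordinates other than i, measurable for \<open>off_coordinate\<close>, and a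
  condition on x i; the defining property of conditional expectation handles the product of the two
  indicators.\<close>

lemma resample_invariant: "\<mu> \<bind> resample i = \<mu>"
proof (rule measure_eqI_PiM_finite[where I=UNIV and M="\<lambda>_. borel" and A="\<lambda>_. UNIV"])
  have R: "resample i \<in> \<mu> \<rightarrow>\<^sub>M subprob_algebra P"
    using measurable_prob_algebraD[OF resample_measurable] by simp
  show sb: "sets (\<mu> \<bind> resample i) = sets P"
    by (rule sets_bind[OF subprob_measurableD(2)[OF R]]) simp_all
  show "sets \<mu> = sets P" by (rule sets_mu)
  have "prob_space (\<mu> \<bind> resample i)"
    by (rule prob_space_bind'[where M=P and N=P])
      (simp_all add: resample_measurable space_prob_algebra prob_space_axioms sets_mu)
  then show "emeasure (\<mu> \<bind> resample i) UNIV \<noteq> \<infinity>"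
    using prob_space.finite_measure[THEN finite_measure.emeasure_finite] by simp
  show "range (\<lambda>_. UNIV :: ('i \<Rightarrow> 'e) set) \<subseteq> prod_algebra UNIV (\<lambda>_. borel)"
    by (auto intro!: prod_algebraI_finite[of UNIV "\<lambda>_. UNIV" "\<lambda>_. borel", simplified])
  fix B :: "'i \<Rightarrow> 'e set" assume B: "\<And>j. j \<in> UNIV \<Longrightarrow> B j \<in> sets borel"
  let ?R = "Pi\<^sub>E UNIV B" and ?D = "{x. \<forall>j. j \<noteq> i \<longrightarrow> x j \<in> B j}"
  let ?F = "off_coordinate \<mu> i"
  interpret F: finite_measure_subalgebra \<mu> ?F by (rule off_coordinate_subalgebra)
  have Rset: "?R \<in> sets P" using B by (intro sets_PiM_I_finite) auto
  have D: "?D \<in> sets ?F"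
  proof -
    have eq: "?D = (\<lambda>x. restrict x (- {i})) -` (Pi\<^sub>E (- {i}) B) \<inter> space \<mu>"
      by (simp add: vimage_def Pi_def)
    have "Pi\<^sub>E (- {i}) B \<in> sets (\<Pi>\<^sub>M j\<in>- {i}. borel)"
      using B by (intro sets_PiM_I_finite) auto
    from in_vimage_algebra[OF this, of "\<lambda>x. restrict x (- {i})" "space \<mu>"] show ?thesis
      unfolding off_coordinate_def eq .
  qed
  have DP: "?D \<in> sets P" using D F.subalg sets_mu by (auto simp: subalgebra_def)
  have Bi: "{x \<in> space P. x i \<in> B i} \<in> sets P" using B by measurable
  have ind: "(\<lambda>y. indicator (B i) (y i) :: real) \<in> borel_measurable P"
    using B by measurable
  have iD: "(indicator ?D :: _ \<Rightarrow> real) \<in> borel_measurable ?F"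
    by (rule borel_measurable_indicator[OF D])
  have "(\<lambda>x. indicator ?D x * indicator (B i) (x i) :: real) \<in> borel_measurable P"
    by (rule borel_measurable_times[OF borel_measurable_indicator[OF DP] ind])
  then have int: "integrable \<mu> (\<lambda>x. indicator ?D x * indicator (B i) (x i) :: real)"
    by (intro integrable_const_bound[where B=1]) (auto simp: indicator_def)
  note cond_exp = F.real_cond_exp_intg[OF int iD, unfolded measurable_mu, OF ind]
  have "emeasure (\<mu> \<bind> resample i) ?R = (\<integral>\<^sup>+x. emeasure (resample i x) ?R \<partial>\<mu>)"
    by (rule emeasure_bind[OF _ R Rset]) simp
  also have "\<dots> = (\<integral>\<^sup>+x. ennreal (indicator ?D x * measure (\<kappa> i x) (B i)) \<partial>\<mu>)"
  proof (intro nn_integral_cong)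
    fix x
    interpret \<kappa>: prob_space "\<kappa> i x" by (rule kernel_prob)
    have "emeasure (resample i x) ?R = emeasure (\<kappa> i x) ((\<lambda>z. x(i := z)) -` ?R \<inter> space (\<kappa> i x))"
      unfolding resample_def by (intro emeasure_distr Rset) (simp add: fun_upd_slice_measurable)
    also have "(\<lambda>z. x(i := z)) -` ?R \<inter> space (\<kappa> i x) = (if x \<in> ?D then B i else {})"
      by (auto simp: PiE_iff split: if_splits)
    finally show "emeasure (resample i x) ?R = ennreal (indicator ?D x * measure (\<kappa> i x) (B i))"
      by (simp add: \<kappa>.emeasure_eq_measure)
  qed
  also have "\<dots> = (\<integral>\<^sup>+x. ennreal (indicator ?D x * real_cond_exp \<mu> ?F (\<lambda>y. indicator (B i) (y i)) x) \<partial>\<mu>)"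
    using kernel_cond_exp[OF B, of i i] by (intro nn_integral_cong_AE) auto
  also have "\<dots> = ennreal (\<integral>x. indicator ?D x * real_cond_exp \<mu> ?F (\<lambda>y. indicator (B i) (y i)) x \<partial>\<mu>)"
  proof (rule nn_integral_eq_integral)
    show "integrable \<mu> (\<lambda>x. indicator ?D x * real_cond_exp \<mu> ?F (\<lambda>y. indicator (B i) (y i)) x)"
      by (rule cond_exp(1))
    show "AE x in \<mu>. 0 \<le> indicator ?D x * real_cond_exp \<mu> ?F (\<lambda>y. indicator (B i) (y i)) x"
      using kernel_cond_exp[OF B[of i, simplified], of i]
    proof eventually_elim
      case (elim x)
      show ?case unfolding elim[symmetric] by simp
    qed
  qed
  also have "(\<integral>x. indicator ?D x * real_cond_exp \<mu> ?F (\<lambda>y. indicator (B i) (y i)) x \<partial>\<mu>) =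
      (\<integral>x. indicator ?D x * indicator (B i) (x i) \<partial>\<mu>)"
    by (rule cond_exp(2))
  also have "\<dots> = (\<integral>x. indicator ?R x \<partial>\<mu>)"
  proof (intro Bochner_Integration.integral_cong refl)
    fix x :: "'i \<Rightarrow> 'e"
    have "x \<in> ?R \<longleftrightarrow> x \<in> ?D \<and> x i \<in> B i" by (auto simp: PiE_iff)
    then show "indicator ?D x * indicator (B i) (x i) = (indicator ?R x :: real)"
      by (simp add: indicator_def)
  qed
  also have "\<dots> = measure \<mu> ?R" by simp
  also have "ennreal \<dots> = emeasure \<mu> ?R" by (simp add: emeasure_eq_measure)
  finally show "emeasure (\<mu> \<bind> resample i) ?R = emeasure \<mu> ?R" .
qed (auto simp: space_PiM)

section \<open>Bounded measurable functions and conditional integration as an orthogonal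
  projection\<close>

lemma bm_measurable: "f \<in> bm \<Longrightarrow> f \<in> borel_measurable P"
  by (simp add: bm_def)

lemma bm_bound: "f \<in> bm \<Longrightarrow> \<exists>K. \<forall>x. \<bar>f x\<bar> \<le> K"
  by (simp add: bm_def)

lemma bmI: "f \<in> borel_measurable P \<Longrightarrow> (\<And>x. \<bar>f x\<bar> \<le> K) \<Longrightarrow> f \<in> bm"
  by (auto simp: bm_def)

lemma bm_integrable:
  assumes f: "f \<in> bm"
  shows "integrable \<mu> f"
proof -
  obtain K where "\<And>x. \<bar>f x\<bar> \<le> K" using bm_bound[OF f] by auto
  then show ?thesis using bm_measurable[OF f] by (intro integrable_const_bound[where B=K]) auto
qed

lemma bm_slice_integrable: "f \<in> bm \<Longrightarrow> integrable (\<kappa> i x) (\<lambda>z. f (y(j := z)))"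
proof -
  assume f: "f \<in> bm"
  interpret \<kappa>: prob_space "\<kappa> i x" by (rule kernel_prob)
  obtain K where "\<And>x. \<bar>f x\<bar> \<le> K" using bm_bound[OF f] by auto
  then show ?thesis
    using measurable_compose[OF fun_upd_slice_measurable bm_measurable[OF f]]
    by (intro \<kappa>.integrable_const_bound[where B=K]) auto
qed

lemma bm_const: "(\<lambda>_. c) \<in> bm" by (rule bmI) auto

lemma bm_mult: "f \<in> bm \<Longrightarrow> h \<in> bm \<Longrightarrow> (\<lambda>x. f x * h x) \<in> bm"
proof -
  assume f: "f \<in> bm" and h: "h \<in> bm"
  obtain K L where "\<And>x. \<bar>f x\<bar> \<le> K" "\<And>x. \<bar>h x\<bar> \<le> L" using bm_bound[OF f] bm_bound[OF h] by auto
  then have "\<bar>f x\<bar> \<le> \<bar>K\<bar>" "\<bar>h x\<bar> \<le> \<bar>L\<bar>" for x by (meson abs_ge_self order_trans)+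
  then have "\<bar>f x * h x\<bar> \<le> \<bar>K\<bar> * \<bar>L\<bar>" for x
    unfolding abs_mult by (intro mult_mono) auto
  then show ?thesis
    by (rule bmI[OF borel_measurable_times[OF bm_measurable[OF f] bm_measurable[OF h]]])
qed

lemma bm_add: "f \<in> bm \<Longrightarrow> h \<in> bm \<Longrightarrow> (\<lambda>x. f x + h x) \<in> bm"
proof -
  assume f: "f \<in> bm" and h: "h \<in> bm"
  obtain K L where "\<And>x. \<bar>f x\<bar> \<le> K" "\<And>x. \<bar>h x\<bar> \<le> L" using bm_bound[OF f] bm_bound[OF h] by auto
  then have "\<bar>f x + h x\<bar> \<le> K + L" for x
    by (intro order_trans[OF abs_triangle_ineq] add_mono)
  then show ?thesis
    by (rule bmI[OF borel_measurable_add[OF bm_measurable[OF f] bm_measurable[OF h]]])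
qed

lemma bm_sum: "(\<And>i. i \<in> I \<Longrightarrow> f i \<in> bm) \<Longrightarrow> (\<lambda>x. \<Sum>i\<in>I. f i x) \<in> bm"
  by (induction I rule: infinite_finite_induct) (auto intro!: bm_const bm_add)

lemma bm_diff: "f \<in> bm \<Longrightarrow> h \<in> bm \<Longrightarrow> (\<lambda>x. f x - h x) \<in> bm"
  using bm_add[of f "\<lambda>x. (-1) * h x"] bm_mult[OF bm_const[of "-1"], of h] by simp

lemma bm_divide: "f \<in> bm \<Longrightarrow> (\<lambda>x. f x / c) \<in> bm"
  using bm_mult[OF bm_const[of "1/c"], of f] by simp

lemma cond_int_bound:
  assumes f: "f \<in> borel_measurable P" and b: "\<And>x. \<bar>f x\<bar> \<le> K"
  shows "\<bar>cond_int \<kappa> i f x\<bar> \<le> K"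
proof -
  interpret \<kappa>: prob_space "\<kappa> i x" by (rule kernel_prob)
  have "\<bar>cond_int \<kappa> i f x\<bar> \<le> (\<integral>z. \<bar>f (x(i := z))\<bar> \<partial>\<kappa> i x)"
    unfolding cond_int_def by (rule integral_abs_bound)
  also have "\<dots> \<le> (\<integral>z. K \<partial>\<kappa> i x)"
    using b bm_slice_integrable[OF bmI[OF f b]] by (intro integral_mono) auto
  finally show ?thesis using \<kappa>.prob_space by simp
qed

lemma cond_int_bm: "f \<in> bm \<Longrightarrow> cond_int \<kappa> i f \<in> bm"
proof -
  assume f: "f \<in> bm"
  note m = bm_measurable[OF f]
  have "(\<lambda>x. \<integral>y. f y \<partial>resample i x) \<in> borel_measurable P"
    by (rule measurable_compose[OF measurable_prob_algebraD[OF resample_measurable] integral_measurable_subprob_algebra[OF m]])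
  then have "cond_int \<kappa> i f \<in> borel_measurable P" using integral_resample[OF m] by simp
  then show ?thesis using bm_bound[OF f] cond_int_bound[OF m] by (auto intro: bmI)
qed

lemma integral_cond_int:
  assumes f: "f \<in> bm"
  shows "(\<integral>x. cond_int \<kappa> i f x \<partial>\<mu>) = (\<integral>x. f x \<partial>\<mu>)"
proof -
  obtain K where K: "\<And>x. \<bar>f x\<bar> \<le> K" using bm_bound[OF f] by auto
  have R: "resample i \<in> \<mu> \<rightarrow>\<^sub>M subprob_algebra P"
    using measurable_prob_algebraD[OF resample_measurable] by simp
  have "(\<integral>x. f x \<partial>\<mu>) = (\<integral>x. f x \<partial>(\<mu> \<bind> resample i))" by (simp add: resample_invariant)
  also have "\<dots> = (\<integral>x. \<integral>y. f y \<partial>resample i x \<partial>\<mu>)"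
  proof (rule integral_bind[OF bm_measurable[OF f] _ R, where B=K and B'=1])
    show "AE x in \<mu>. emeasure (resample i x) (space (resample i x)) \<le> ennreal 1"
      using measurable_space[OF resample_measurable]
      by (intro always_eventually allI) (simp add: space_PiM space_prob_algebra prob_space.emeasure_space_1)
  qed (use K finite_measure_axioms in auto)
  also have "\<dots> = (\<integral>x. cond_int \<kappa> i f x \<partial>\<mu>)" using integral_resample[OF bm_measurable[OF f]] by simp
  finally show ?thesis by simp
qed

lemma cond_int_upd: "cond_int \<kappa> i f (x(i := z)) = cond_int \<kappa> i f x"
  using kernel_cong[of i "x(i := z)" x] by (simp add: cond_int_def)

lemma cond_int_mult_left:
  assumes "\<And>z. h (x(i := z)) = h x"
  shows "cond_int \<kappa> i (\<lambda>y. h y * f y) x = h x * cond_int \<kappa> i f x"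
  by (simp add: cond_int_def assms)

text \<open>\<open>cond_int \<kappa> i f\<close> is constant in the i-th coordinate and can be
  pulled out when that coordinate is resampled. The right-hand side is symmetric in f and h, which
  gives self-adjointness of each resampling.\<close>

lemma cond_int_projection:
  assumes f: "f \<in> bm" and h: "h \<in> bm"
  shows "(\<integral>x. cond_int \<kappa> i f x * h x \<partial>\<mu>) = (\<integral>x. cond_int \<kappa> i f x * cond_int \<kappa> i h x \<partial>\<mu>)"
proof -
  have "(\<integral>x. cond_int \<kappa> i f x * h x \<partial>\<mu>) = (\<integral>x. cond_int \<kappa> i (\<lambda>y. cond_int \<kappa> i f y * h y) x \<partial>\<mu>)"
    by (rule integral_cond_int[symmetric]) (intro bm_mult cond_int_bm f h)
  then show ?thesis by (simp add: cond_int_mult_left cond_int_upd)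
qed

end

section \<open>Contraction of Lipschitz constants\<close>

text \<open>Finiteness of the coefficient is essential here: \<open>enn2real\<close> sends infinity
  to 0, which would falsify the bound.\<close>

lemma W1_kernel_bound:
  assumes c: "dobrushin_coeff \<kappa> i j < \<infinity>" and xy: "\<And>k. k \<noteq> j \<Longrightarrow> x k = y k" "x j \<noteq> y j"
  shows "W1 (\<kappa> i x) (\<kappa> i y) \<le> ennreal (enn2real (dobrushin_coeff \<kappa> i j) * dist (x j) (y j))"
proof -
  let ?d = "ennreal (dist (x j) (y j))"
  have d: "?d \<noteq> 0" "?d \<noteq> \<infinity>" using xy(2) by (auto simp: zero_less_dist_iff)
  have "W1 (\<kappa> i x) (\<kappa> i y) / ?d \<le> dobrushin_coeff \<kappa> i j"
    unfolding dobrushin_coeff_def using xy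
    by (intro SUP_upper2[where i="(x, y)"]) auto
  then have "W1 (\<kappa> i x) (\<kappa> i y) / ?d * ?d \<le> dobrushin_coeff \<kappa> i j * ?d"
    by (intro mult_right_mono) auto
  also have "W1 (\<kappa> i x) (\<kappa> i y) / ?d * ?d = W1 (\<kappa> i x) (\<kappa> i y)"
    unfolding ennreal_divide_times using d by (simp add: top.not_eq_extremum)
  also have "dobrushin_coeff \<kappa> i j * ?d = ennreal (enn2real (dobrushin_coeff \<kappa> i j) * dist (x j) (y j))"
    using c by (simp add: ennreal_mult ennreal_enn2real)
  finally show ?thesis .
qed

context gibbs
begin

abbreviation c :: "'i \<Rightarrow> 'i \<Rightarrow> real" where
  "c i j \<equiv> enn2real (dobrushin_coeff \<kappa> i j)"

text \<open>The elementary half of Kantorovich duality, written out for an arbitrary coupling p. The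
  arguments of f differ in two places: coordinate i changes from \<open>fst q\<close> to
  \<open>snd q\<close>, at cost u i times their distance, and then coordinate j from z to z'. Since
  i and j differ, the two updates commute.\<close>

lemma coupling_bound:
  assumes f: "f \<in> bm" and lip: "coord_lipschitz u f" and u: "\<And>i. u i \<ge> 0"
    and ij: "i \<noteq> j"
    and p: "p \<in> couplings (\<kappa> i (x(j := z))) (\<kappa> i (x(j := z')))"
  shows "ennreal \<bar>cond_int \<kappa> i f (x(j := z)) - cond_int \<kappa> i f (x(j := z'))\<bar>
    \<le> ennreal (u i) * (\<integral>\<^sup>+ q. ennreal (dist (fst q) (snd q)) \<partial>p) + ennreal (u j * dist z z')"
proof -
  let ?X = "x(j := z)" and ?Y = "x(j := z')"
  have sp: "sets p = sets (borel \<Otimes>\<^sub>M borel)" and X: "distr p borel fst = \<kappa> i ?X"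
    and Y: "distr p borel snd = \<kappa> i ?Y"
    using p by (auto simp: couplings_def)
  have mp [simp]: "measurable p N = measurable (borel \<Otimes>\<^sub>M borel) N" for N :: "'z measure"
    by (intro measurable_cong_sets sp refl)
  have fs: "fst \<in> p \<rightarrow>\<^sub>M borel" "snd \<in> p \<rightarrow>\<^sub>M borel" by simp_all
  interpret p: prob_space p
    using kernel_prob[of i ?X] unfolding X[symmetric] by (rule prob_space_distrD[OF fs(1)])
  let ?F = "\<lambda>w. f (?X(i := w))" and ?G = "\<lambda>w. f (?Y(i := w))"
  have F: "?F \<in> borel_measurable borel" and G: "?G \<in> borel_measurable borel"
    by (rule measurable_compose[OF fun_upd_slice_measurable bm_measurable[OF f]])+
  have Fi: "integrable p (\<lambda>q. ?F (fst q))"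
    using bm_slice_integrable[OF f, of i ?X ?X i] unfolding X[symmetric]
    by (simp add: integrable_distr_eq[OF fs(1)] F)
  have Gi: "integrable p (\<lambda>q. ?G (snd q))"
    using bm_slice_integrable[OF f, of i ?Y ?Y i] unfolding Y[symmetric]
    by (simp add: integrable_distr_eq[OF fs(2)] G)
  have "cond_int \<kappa> i f ?X - cond_int \<kappa> i f ?Y = (\<integral>q. ?F (fst q) \<partial>p) - (\<integral>q. ?G (snd q) \<partial>p)"
    unfolding cond_int_def X[symmetric] Y[symmetric]
    by (simp add: integral_distr[OF fs(1) F] integral_distr[OF fs(2) G])
  also have "\<dots> = (\<integral>q. ?F (fst q) - ?G (snd q) \<partial>p)" using Fi Gi by simp
  finally have "ennreal \<bar>cond_int \<kappa> i f ?X - cond_int \<kappa> i f ?Y\<bar> =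
      ennreal (norm (\<integral>q. ?F (fst q) - ?G (snd q) \<partial>p))" by simp
  also have "\<dots> \<le> (\<integral>\<^sup>+q. ennreal (norm (?F (fst q) - ?G (snd q))) \<partial>p)"
    by (intro integral_norm_bound_ennreal Bochner_Integration.integrable_diff Fi Gi)
  also have "\<dots> \<le> (\<integral>\<^sup>+q. ennreal (u i) * ennreal (dist (fst q) (snd q)) + ennreal (u j * dist z z') \<partial>p)"
  proof (intro nn_integral_mono)
    fix q :: "'e \<times> 'e"
    have "\<bar>f (?X(i := fst q)) - f (?X(i := snd q))\<bar> \<le> u i * dist (fst q) (snd q)"
      using lip unfolding coord_lipschitz_def by blast
    moreover have "\<bar>f ((x(i := snd q))(j := z)) - f ((x(i := snd q))(j := z'))\<bar> \<le> u j * dist z z'"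
      using lip unfolding coord_lipschitz_def by blast
    ultimately have "norm (?F (fst q) - ?G (snd q)) \<le> u i * dist (fst q) (snd q) + u j * dist z z'"
      using fun_upd_twist[OF ij, of x] by simp
    then have "ennreal (norm (?F (fst q) - ?G (snd q))) \<le> ennreal (u i * dist (fst q) (snd q) + u j * dist z z')"
      by (rule ennreal_leI)
    also have "\<dots> = ennreal (u i) * ennreal (dist (fst q) (snd q)) + ennreal (u j * dist z z')"
      using u by (simp add: ennreal_plus ennreal_mult)
    finally show "ennreal (norm (?F (fst q) - ?G (snd q)))
      \<le> ennreal (u i) * ennreal (dist (fst q) (snd q)) + ennreal (u j * dist z z')" .
  qed
  also have "\<dots> = ennreal (u i) * (\<integral>\<^sup>+ q. ennreal (dist (fst q) (snd q)) \<partial>p) + ennreal (u j * dist z z')"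
    by (simp add: nn_integral_add nn_integral_cmult p.emeasure_space_1)
  finally show ?thesis .
qed

lemma cond_int_coord_lipschitz:
  assumes fin: "\<And>i j. dobrushin_coeff \<kappa> i j < \<infinity>"
    and f: "f \<in> bm" and lip: "coord_lipschitz u f" and u: "\<And>i. u i \<ge> 0"
  shows "coord_lipschitz (\<lambda>j. (if j = i then 0 else u j) + c i j * u i) (cond_int \<kappa> i f)"
  unfolding coord_lipschitz_def
proof (intro allI)
  fix j and x :: "'i \<Rightarrow> 'e" and z z' :: 'e
  let ?X = "x(j := z)" and ?Y = "x(j := z')"
  let ?D = "\<bar>cond_int \<kappa> i f ?X - cond_int \<kappa> i f ?Y\<bar>"
  show "?D \<le> ((if j = i then 0 else u j) + c i j * u i) * dist z z'"
  \<comment> \<open>For j = i the conditional integral does not change at all; pairs with z = z' lie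
    outside the supremum defining the coefficient.\<close>
  proof (cases "j = i \<or> z = z'")
    case True
    then show ?thesis using u by (auto simp: cond_int_upd)
  next
    case False
    show ?thesis
    proof (rule field_le_epsilon)
      fix e :: real assume e: "e > 0"
      \<comment> \<open>A coupling within e' of the infimum adds at most u i * e' to the bound. The
        + 1 covers u i = 0.\<close>
      define e' where "e' = e / (u i + 1)"
      have e': "e' > 0" "u i * e' \<le> e"
        using e u[of i] by (auto simp: e'_def field_simps)
      have "W1 (\<kappa> i ?X) (\<kappa> i ?Y) \<le> ennreal (c i j * dist z z')"
        using W1_kernel_bound[OF fin, of j ?X ?Y i] False by simp
      also have "\<dots> < ennreal (c i j * dist z z' + e')"
        using e' by (intro ennreal_lessI) (auto intro!: add_nonneg_pos mult_nonneg_nonneg)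
      finally obtain p where p: "p \<in> couplings (\<kappa> i ?X) (\<kappa> i ?Y)"
        and pl: "(\<integral>\<^sup>+ q. ennreal (dist (fst q) (snd q)) \<partial>p) < ennreal (c i j * dist z z' + e')"
        unfolding W1_def INF_less_iff by blast
      have "ennreal ?D \<le> ennreal (u i) * (\<integral>\<^sup>+ q. ennreal (dist (fst q) (snd q)) \<partial>p) + ennreal (u j * dist z z')"
        using False by (intro coupling_bound[OF f lip u _ p]) auto
      also have "\<dots> \<le> ennreal (u i) * ennreal (c i j * dist z z' + e') + ennreal (u j * dist z z')"
        using pl by (intro add_right_mono mult_left_mono) auto
      also have "\<dots> = ennreal (u i * (c i j * dist z z' + e') + u j * dist z z')"
        using u e' by (simp add: ennreal_plus ennreal_mult)
      finally have "?D \<le> u i * (c i j * dist z z' + e') + u j * dist z z'"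
        using u e' by (subst (asm) ennreal_le_iff) auto
      then show "?D \<le> ((if j = i then 0 else u j) + c i j * u i) * dist z z' + e"
        using False e'(2) by (simp add: algebra_simps)
    qed
  qed
qed

text \<open>The random-scan Gibbs sampler: a uniformly chosen coordinate is resampled.\<close>

definition gibbs_step :: "(('i \<Rightarrow> 'e) \<Rightarrow> real) \<Rightarrow> ('i \<Rightarrow> 'e) \<Rightarrow> real" where
  "gibbs_step f x = (\<Sum>i\<in>UNIV. cond_int \<kappa> i f x) / CARD('i)"

text \<open>\<open>dobrushin_step\<close> is the matrix \<open>((n - 1) I + C\<^sup>T) / n\<close> with \<open>n = CARD('i)\<close>.\<close>

definition dobrushin_step :: "('i \<Rightarrow> real) \<Rightarrow> 'i \<Rightarrow> real" where
  "dobrushin_step u j = ((real CARD('i) - 1) * u j + (\<Sum>i\<in>UNIV. c i j * u i)) / CARD('i)"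

lemma gibbs_step_coord_lipschitz:
  assumes fin: "\<And>i j. dobrushin_coeff \<kappa> i j < \<infinity>"
    and f: "f \<in> bm" and lip: "coord_lipschitz u f" and u: "\<And>i. u i \<ge> 0"
  shows "coord_lipschitz (dobrushin_step u) (gibbs_step f)"
  unfolding coord_lipschitz_def
proof (intro allI)
  fix j and x :: "'i \<Rightarrow> 'e" and z z' :: 'e
  have "\<bar>gibbs_step f (x(j := z)) - gibbs_step f (x(j := z'))\<bar> =
      \<bar>\<Sum>i\<in>UNIV. cond_int \<kappa> i f (x(j := z)) - cond_int \<kappa> i f (x(j := z'))\<bar> / CARD('i)"
    by (simp add: gibbs_step_def sum_subtractf diff_divide_distrib[symmetric])
  also have "\<dots> \<le> (\<Sum>i\<in>UNIV. ((if j = i then 0 else u j) + c i j * u i) * dist z z') / CARD('i)"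
    using cond_int_coord_lipschitz[OF fin f lip u] unfolding coord_lipschitz_def
    by (intro divide_right_mono sum_abs[THEN order_trans] sum_mono) auto
  also have "(\<Sum>i\<in>UNIV. ((if j = i then 0 else u j) + c i j * u i) * dist z z') =
    ((real CARD('i) - 1) * u j + (\<Sum>i\<in>UNIV. c i j * u i)) * dist z z'"
  proof -
    \<comment> \<open>Of the n resamplings, only that of j itself forgets u j; hence the factor n -
      1.\<close>
    have "(\<Sum>i\<in>UNIV. if j = i then 0 else u j) = (\<Sum>i\<in>UNIV - {j}. u j)"
      by (intro sum.mono_neutral_cong_right) auto
    also have "\<dots> = (real CARD('i) - 1) * u j" by (simp add: card_Diff_singleton of_nat_diff)
    finally show ?thesis by (simp add: sum_distrib_right[symmetric] sum.distrib)
  qed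
  finally have "\<bar>gibbs_step f (x(j := z)) - gibbs_step f (x(j := z'))\<bar> \<le>
    ((real CARD('i) - 1) * u j + (\<Sum>i\<in>UNIV. c i j * u i)) * dist z z' / CARD('i)" .
  then show "\<bar>gibbs_step f (x(j := z)) - gibbs_step f (x(j := z'))\<bar> \<le> dobrushin_step u j * dist z z'"
    by (simp only: dobrushin_step_def times_divide_eq_left)
qed

lemma dobrushin_step_nonneg: "(\<And>i. u i \<ge> 0) \<Longrightarrow> dobrushin_step u j \<ge> 0"
  unfolding dobrushin_step_def by (intro divide_nonneg_nonneg add_nonneg_nonneg mult_nonneg_nonneg sum_nonneg)
    (auto simp: Suc_le_eq)

lemma gibbs_step_bm: "f \<in> bm \<Longrightarrow> gibbs_step f \<in> bm"
  unfolding gibbs_step_def[abs_def] by (intro bm_divide bm_sum cond_int_bm)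

lemma gibbs_step_integral:
  assumes "f \<in> bm" shows "(\<integral>x. gibbs_step f x \<partial>\<mu>) = (\<integral>x. f x \<partial>\<mu>)"
proof -
  have "(\<integral>x. gibbs_step f x \<partial>\<mu>) = (\<Sum>i\<in>(UNIV::'i set). \<integral>x. cond_int \<kappa> i f x \<partial>\<mu>) / CARD('i)"
    unfolding gibbs_step_def using assms by (simp add: bm_integrable cond_int_bm)
  then show ?thesis by (simp add: integral_cond_int[OF assms])
qed

lemma gibbs_step_integral_mult:
  assumes "f \<in> bm" "h \<in> bm"
  shows "(\<integral>x. gibbs_step f x * h x \<partial>\<mu>) = (\<Sum>i\<in>UNIV. \<integral>x. cond_int \<kappa> i f x * h x \<partial>\<mu>) / CARD('i)"
  unfolding gibbs_step_def using assms
  by (simp add: sum_distrib_right bm_integrable bm_mult cond_int_bm)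

lemma gibbs_step_symmetric:
  assumes f: "f \<in> bm" and h: "h \<in> bm"
  shows "(\<integral>x. gibbs_step f x * h x \<partial>\<mu>) = (\<integral>x. f x * gibbs_step h x \<partial>\<mu>)"
proof -
  have "(\<integral>x. cond_int \<kappa> i f x * h x \<partial>\<mu>) = (\<integral>x. cond_int \<kappa> i h x * f x \<partial>\<mu>)" for i
    unfolding cond_int_projection[OF f h] cond_int_projection[OF h f] by (simp add: mult.commute)
  then have "(\<integral>x. gibbs_step f x * h x \<partial>\<mu>) = (\<integral>x. gibbs_step h x * f x \<partial>\<mu>)"
    by (simp add: gibbs_step_integral_mult f h)
  then show ?thesis by (simp add: mult.commute)
qed

end

section \<open>Powers of the interdependence matrix\<close>

lemma smult_mat_mult_vec:
  fixes a :: "'a::comm_ring_1"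
  assumes "A \<in> carrier_mat n m" "v \<in> carrier_vec m"
  shows "(a \<cdot>\<^sub>m A) *\<^sub>v v = a \<cdot>\<^sub>v (A *\<^sub>v v)"
  using assms by (intro eq_vecI) auto

lemma spectrum_affine:
  fixes C :: "complex mat"
  assumes C: "C \<in> carrier_mat n n" and b: "b \<noteq> 0"
    and l: "l \<in> spectrum (a \<cdot>\<^sub>m 1\<^sub>m n + b \<cdot>\<^sub>m C)"
  shows "(l - a) / b \<in> spectrum C"
proof -
  let ?M = "a \<cdot>\<^sub>m 1\<^sub>m n + b \<cdot>\<^sub>m C"
  obtain v where v: "v \<in> carrier_vec n" "v \<noteq> 0\<^sub>v n" "?M *\<^sub>v v = l \<cdot>\<^sub>v v"
    using l C unfolding spectrum_def eigenvalue_def eigenvector_def by auto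
  have "?M *\<^sub>v v = a \<cdot>\<^sub>v v + b \<cdot>\<^sub>v (C *\<^sub>v v)"
    using C v by (simp add: add_mult_distrib_mat_vec[of _ n n] smult_mat_mult_vec[of _ n n])
  then have eq: "a \<cdot>\<^sub>v v + b \<cdot>\<^sub>v (C *\<^sub>v v) = l \<cdot>\<^sub>v v" using v by simp
  have "C *\<^sub>v v = ((l - a) / b) \<cdot>\<^sub>v v"
  proof (rule eq_vecI)
    fix i assume "i < dim_vec (((l - a) / b) \<cdot>\<^sub>v v)"
    then have i: "i < n" using v by simp
    have "(a \<cdot>\<^sub>v v + b \<cdot>\<^sub>v (C *\<^sub>v v)) $ i = (l \<cdot>\<^sub>v v) $ i" by (simp only: eq)
    then have "a * v $ i + b * (C *\<^sub>v v) $ i = l * v $ i"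
      using i v(1) C by (simp del: index_mult_mat_vec)
    then have "(C *\<^sub>v v) $ i = (l - a) / b * v $ i"
      using b by (simp add: field_simps)
    then show "(C *\<^sub>v v) $ i = (((l - a) / b) \<cdot>\<^sub>v v) $ i" using i v(1) by simp
  qed (use C v in auto)
  then show ?thesis
    using v C unfolding spectrum_def eigenvalue_def eigenvector_def by auto
qed

text \<open>An eigenvalue of the affine matrix comes from one of C, so the triangle inequality puts
  the spectral radius below 1 after division by s; the Jordan normal form then bounds all powers by
  one K.\<close>

lemma affine_power_bound:
  fixes C :: "complex mat" and a b s :: real
  assumes C: "C \<in> carrier_mat n n" and n: "n > 0" and a: "a \<ge> 0" and b: "b > 0"
    and s: "a + b * spectral_radius C < s"
  obtains K where "\<And>k. norm_bound
    ((complex_of_real (a / s) \<cdot>\<^sub>m 1\<^sub>m n + complex_of_real (b / s) \<cdot>\<^sub>m C) ^\<^sub>m k) K"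
proof -
  let ?M = "complex_of_real (a / s) \<cdot>\<^sub>m 1\<^sub>m n + complex_of_real (b / s) \<cdot>\<^sub>m C"
  have M: "?M \<in> carrier_mat n n" using C by simp
  have r: "spectral_radius C \<ge> 0" using spectral_radius_mem_max(1)[OF C n] by auto
  have s0: "s > 0" using s a b r by (smt (verit) mult_nonneg_nonneg)
  have "spectral_radius ?M \<in> norm ` spectrum ?M" by (rule spectral_radius_mem_max[OF M n])
  then obtain l where l: "l \<in> spectrum ?M" "spectral_radius ?M = norm l" by auto
  let ?e = "(l - complex_of_real (a / s)) / complex_of_real (b / s)"
  have "?e \<in> spectrum C" using b s0 by (intro spectrum_affine[OF C _ l(1)]) simp
  then have e: "norm ?e \<le> spectral_radius C" by (intro spectral_radius_mem_max(2)[OF C n]) auto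
  have "l = complex_of_real (a / s) + complex_of_real (b / s) * ?e" using b s0 by simp
  then have "norm l \<le> norm (complex_of_real (a / s)) + norm (complex_of_real (b / s) * ?e)"
    by (metis norm_triangle_ineq)
  also have "\<dots> = a / s + b / s * norm ?e" using a b s0 unfolding norm_mult norm_of_real by simp
  also have "\<dots> \<le> a / s + b / s * spectral_radius C"
    using e b s0 by (intro add_left_mono mult_left_mono) auto
  also have "\<dots> = (a + b * spectral_radius C) / s" by (simp add: add_divide_distrib)
  also have "\<dots> < 1" using s s0 by simp
  finally have "spectral_radius ?M < 1" using l(2) by simp
  from spectral_radius_jnf_norm_bound_less_1_upper_triangular[OF M this] that show ?thesis by auto
qed

text \<open>u k / s ^ k is the row vector u 0 times the k-th power of M / s, and K bounds the
  entries of that power. Working with row vectors accounts for the transpose of C, so the matrix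
  itself is never transposed. The bijection e passes between the index type and initial segments of
  the naturals.\<close>

lemma linear_recursion_bound:
  fixes M :: "'i::finite \<Rightarrow> 'i \<Rightarrow> real" and u :: "nat \<Rightarrow> 'i \<Rightarrow> real"
  assumes e: "bij_betw e {..<n} UNIV" and s: "s > 0"
    and bound: "\<And>k. norm_bound (mat n n (\<lambda>(i, j). complex_of_real (M (e i) (e j) / s)) ^\<^sub>m k) K"
    and u: "\<And>k j. u (Suc k) j = (\<Sum>i\<in>UNIV. u k i * M i j)"
  shows "\<bar>u k j\<bar> \<le> K * (\<Sum>i\<in>UNIV. \<bar>u 0 i\<bar>) * s ^ k"
proof -
  let ?A = "mat n n (\<lambda>(i, j). complex_of_real (M (e i) (e j) / s))"
  have A: "?A \<in> carrier_mat n n" by simp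
  note sum_e = sum.reindex_bij_betw[OF e]
  have main: "j < n \<Longrightarrow> complex_of_real (u k (e j) / s ^ k) = (\<Sum>i<n. complex_of_real (u 0 (e i)) * (?A ^\<^sub>m k) $$ (i, j))" for j
  proof (induction k arbitrary: j)
    case 0
    then show ?case by (simp add: if_distrib sum.delta cong: if_cong)
  next
    case (Suc k)
    have p: "?A ^\<^sub>m k \<in> carrier_mat n n" using A by (rule pow_carrier_mat)
    have "(\<Sum>i<n. complex_of_real (u 0 (e i)) * (?A ^\<^sub>m Suc k) $$ (i, j)) =
      (\<Sum>i<n. complex_of_real (u 0 (e i)) * (\<Sum>l<n. (?A ^\<^sub>m k) $$ (i, l) * ?A $$ (l, j)))"
      using p Suc.prems by (intro sum.cong refl) (simp add: scalar_prod_def lessThan_atLeast0)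
    also have "\<dots> = (\<Sum>l<n. (\<Sum>i<n. complex_of_real (u 0 (e i)) * (?A ^\<^sub>m k) $$ (i, l)) * ?A $$ (l, j))"
      unfolding sum_distrib_left sum_distrib_right by (subst sum.swap) (simp add: mult.assoc)
    also have "\<dots> = (\<Sum>l<n. complex_of_real (u k (e l) / s ^ k) * complex_of_real (M (e l) (e j) / s))"
      using Suc by (intro sum.cong refl) simp
    also have "\<dots> = complex_of_real ((\<Sum>l<n. u k (e l) * M (e l) (e j)) / s ^ Suc k)"
      by (simp add: sum_divide_distrib mult.commute)
    also have "(\<Sum>l<n. u k (e l) * M (e l) (e j)) = u (Suc k) (e j)"
      unfolding u by (rule sum_e)
    finally show ?case by simp
  qed
  obtain l where l: "l < n" "j = e l" using e by (auto simp: bij_betw_def)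
  have "\<bar>u k j\<bar> / s ^ k = norm (complex_of_real (u k (e l) / s ^ k))"
    using s l by (simp add: abs_divide del: of_real_divide)
  also have "\<dots> \<le> (\<Sum>i<n. \<bar>u 0 (e i)\<bar> * K)"
    unfolding main[OF l(1)]
  proof (intro order_trans[OF norm_sum] sum_mono)
    fix i assume "i \<in> {..<n}"
    then have "norm ((?A ^\<^sub>m k) $$ (i, l)) \<le> K"
      using bound[of k] l pow_carrier_mat[OF A, of k] unfolding norm_bound_def by auto
    then show "norm (complex_of_real (u 0 (e i)) * (?A ^\<^sub>m k) $$ (i, l)) \<le> \<bar>u 0 (e i)\<bar> * K"
      by (simp add: norm_mult mult_left_mono)
  qed
  also have "\<dots> = K * (\<Sum>i\<in>UNIV. \<bar>u 0 i\<bar>)"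
    unfolding sum_distrib_right[symmetric] sum_e[of "\<lambda>i. \<bar>u 0 i\<bar>"] by (rule mult.commute)
  finally show ?thesis using s by (simp add: field_simps)
qed

lemma dobrushin_matrix_affine:
  fixes \<kappa> :: "'i::finite \<Rightarrow> ('i \<Rightarrow> 'e::metric_space) \<Rightarrow> 'e measure"
  shows "complex_of_real x \<cdot>\<^sub>m 1\<^sub>m CARD('i) + complex_of_real y \<cdot>\<^sub>m dobrushin_matrix \<kappa> =
    mat CARD('i) CARD('i) (\<lambda>(k, l). complex_of_real
      ((if from_nat_into UNIV k = (from_nat_into UNIV l :: 'i) then x else 0)
        + y * enn2real (dobrushin_coeff \<kappa> (from_nat_into UNIV k) (from_nat_into UNIV l))))"
proof -
  have "inj_on (from_nat_into (UNIV :: 'i set)) {..<CARD('i)}"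
    using bij_betw_from_nat_into_finite[of "UNIV :: 'i set"] by (simp add: bij_betw_def)
  then have "from_nat_into UNIV k = (from_nat_into UNIV l :: 'i) \<longleftrightarrow> k = l"
    if "k < CARD('i)" "l < CARD('i)" for k l
    using that by (auto dest: inj_onD)
  then show ?thesis
    by (intro eq_matI) (auto simp: dobrushin_matrix_def)
qed

section \<open>Spectral gap\<close>

text \<open>By log-convexity the ratios of consecutive terms never decrease. If the first one
  exceeded q, b would grow at least geometrically with a rate above q, which no constant K can
  absorb. Positivity is carried through the induction so that ratios can be compared.\<close>

lemma log_convex_decay:
  fixes b :: "nat \<Rightarrow> real"
  assumes b: "\<And>k. b k \<ge> 0" and convex: "\<And>k. (b (Suc k))\<^sup>2 \<le> b k * b (Suc (Suc k))"
    and q: "q > 0" and bound: "\<And>k. b k \<le> K * q ^ k"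
  shows "b 1 \<le> q * b 0"
proof (rule ccontr)
  assume "\<not> b 1 \<le> q * b 0"
  then have less: "q * b 0 < b 1" by simp
  then have b1: "b 1 > 0" using b[of 0] q by (smt (verit) mult_nonneg_nonneg)
  have "b 0 \<noteq> 0" using convex[of 0] b1 by auto
  then have b0: "b 0 > 0" using b[of 0] by simp
  define t where "t = b 1 / b 0"
  have t: "t > q" "t > 0" using less b0 b1 by (auto simp: t_def field_simps)
  have step: "b k > 0 \<and> t * b k \<le> b (Suc k)" for k
  proof (induction k)
    case 0
    then show ?case using b0 by (simp add: t_def)
  next
    case (Suc k)
    have pos: "b (Suc k) > 0" using Suc t(2) by (smt (verit) mult_pos_pos)
    have "t * b (Suc k) * b k \<le> b (Suc k) * b (Suc k)"
      using mult_right_mono[OF conjunct2[OF Suc] less_imp_le[OF pos]] by (simp add: mult_ac)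
    also have "\<dots> \<le> b (Suc (Suc k)) * b k"
      using convex[of k] by (simp add: power2_eq_square mult.commute)
    finally show ?case using pos Suc by simp
  qed
  have growth: "t ^ k * b 0 \<le> b k" for k
  proof (induction k)
    case (Suc k)
    have "t ^ Suc k * b 0 \<le> t * b k" using Suc t(2) by (simp add: mult.assoc mult_left_mono)
    then show ?case using step[of k] by linarith
  qed simp
  have "(t / q) ^ k \<le> K / b 0" for k
    using order_trans[OF growth bound, of k] b0 q by (simp add: power_divide field_simps)
  moreover obtain k where "K / b 0 < (t / q) ^ k"
    using real_arch_pow[of "t / q" "K / b 0"] t q by auto
  ultimately show False by (simp add: not_less[symmetric])
qed

lemma le_of_forall_gt:
  fixes x b \<rho> :: real
  assumes "b \<ge> 0" "\<And>s. s > \<rho> \<Longrightarrow> x \<le> s * b"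
  shows "x \<le> \<rho> * b"
proof (rule field_le_epsilon)
  fix e :: real assume e: "e > 0"
  \<comment> \<open>The + 1 covers b = 0; since b / (b + 1) is at most 1, the error is at most
    e.\<close>
  have "x \<le> (\<rho> + e / (b + 1)) * b" using assms e by (intro assms(2)) simp
  also have "\<dots> = \<rho> * b + e * (b / (b + 1))" by (simp add: algebra_simps)
  also have "\<dots> \<le> \<rho> * b + e" using assms(1) e mult_left_mono[of "b / (b + 1)" 1 e] by simp
  finally show "x \<le> \<rho> * b + e" .
qed

context gibbs
begin

lemma integral_cauchy_schwarz:
  assumes f: "f \<in> bm" and h: "h \<in> bm"
  shows "(\<integral>x. f x * h x \<partial>\<mu>)\<^sup>2 \<le> (\<integral>x. (f x)\<^sup>2 \<partial>\<mu>) * (\<integral>x. (h x)\<^sup>2 \<partial>\<mu>)"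
proof -
  define F where "F = (\<integral>x. (f x)\<^sup>2 \<partial>\<mu>)"
  define G where "G = (\<integral>x. f x * h x \<partial>\<mu>)"
  define H where "H = (\<integral>x. (h x)\<^sup>2 \<partial>\<mu>)"
  have i: "integrable \<mu> (\<lambda>x. (f x)\<^sup>2)" "integrable \<mu> (\<lambda>x. f x * h x)" "integrable \<mu> (\<lambda>x. (h x)\<^sup>2)"
    unfolding power2_eq_square by (intro bm_integrable bm_mult f h)+
  have quad: "0 \<le> s\<^sup>2 * F - 2 * s * t * G + t\<^sup>2 * H" for s t
  proof -
    have "0 \<le> (\<integral>x. (s * f x - t * h x)\<^sup>2 \<partial>\<mu>)" by simp
    also have "\<dots> = (\<integral>x. s\<^sup>2 * (f x)\<^sup>2 - 2 * s * t * (f x * h x) + t\<^sup>2 * (h x)\<^sup>2 \<partial>\<mu>)"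
      by (simp add: power2_eq_square algebra_simps)
    also have "\<dots> = s\<^sup>2 * F - 2 * s * t * G + t\<^sup>2 * H"
      using i by (simp add: F_def G_def H_def)
    finally show ?thesis .
  qed
  have F: "F \<ge> 0" and H: "H \<ge> 0" by (simp_all add: F_def H_def)
  have "G\<^sup>2 \<le> F * H"
  proof (cases "H = 0")
    case False
    \<comment> \<open>The coefficients s = H and t = G are the minimising ones up to
      scaling.\<close>
    have "0 \<le> H * (F * H - G\<^sup>2)" using quad[of H G] by (simp add: power2_eq_square algebra_simps)
    then show ?thesis using False H by (simp add: zero_le_mult_iff)
  next
    case True
    \<comment> \<open>With H = 0 the form is G^2 F - 2 G^2 (F + 1) = - G^2 (F + 2) at s = G, t = F +
      1, which forces G = 0.\<close>
    have "G\<^sup>2 * (F + 2) \<le> 0" using quad[of G "F + 1"] True by (simp add: power2_eq_square algebra_simps)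
    moreover have "F + 2 > 0" using F by simp
    ultimately have "G\<^sup>2 \<le> 0" by (simp add: mult_le_0_iff)
    then show ?thesis using True by simp
  qed
  then show ?thesis by (simp add: F_def G_def H_def)
qed

text \<open>Here the second moment assumption enters. Among constants the mean is the best quadratic
  approximation, so for centred h the constant 0 may be replaced by h y; h x - h y is then
  controlled by the coordinate distances, and Cauchy-Schwarz over the coordinates separates
  Lipschitz constants from distances.\<close>

lemma second_moment_bound:
  assumes y: "\<And>i. (\<integral>\<^sup>+ x. ennreal ((dist (x i) (y i))\<^sup>2) \<partial>\<mu>) < \<infinity>"
    and h: "h \<in> bm" and mean: "(\<integral>x. h x \<partial>\<mu>) = 0" and lip: "coord_lipschitz v h"
  shows "(\<integral>x. (h x)\<^sup>2 \<partial>\<mu>) \<le> (\<Sum>i\<in>UNIV. (v i)\<^sup>2) * (\<Sum>i\<in>UNIV. \<integral>x. (dist (x i) (y i))\<^sup>2 \<partial>\<mu>)"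
proof -
  have d: "integrable \<mu> (\<lambda>x. (dist (x i) (y i))\<^sup>2)" for i
  proof (rule integrableI_bounded)
    have "(\<lambda>x::'i \<Rightarrow> 'e. dist (x i) (y i)) \<in> borel_measurable P"
      by (intro borel_measurable_dist measurable_component_singleton measurable_const) auto
    then show "(\<lambda>x. (dist (x i) (y i))\<^sup>2) \<in> borel_measurable \<mu>" by simp
  qed (use y in simp)
  have h2: "integrable \<mu> (\<lambda>x. (h x)\<^sup>2)" unfolding power2_eq_square by (intro bm_integrable bm_mult h)
  have "(\<integral>x. (h x)\<^sup>2 \<partial>\<mu>) \<le> (\<integral>x. (h x)\<^sup>2 \<partial>\<mu>) - 2 * h y * (\<integral>x. h x \<partial>\<mu>) + (h y)\<^sup>2" by (simp add: mean)
  also have "\<dots> = (\<integral>x. (h x)\<^sup>2 - 2 * h y * h x + (h y)\<^sup>2 \<partial>\<mu>)"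
    using h2 bm_integrable[OF h] by simp
  also have "\<dots> \<le> (\<integral>x. (\<Sum>i\<in>UNIV. (v i)\<^sup>2) * (\<Sum>i\<in>UNIV. (dist (x i) (y i))\<^sup>2) \<partial>\<mu>)"
  proof (rule integral_mono)
    show "integrable \<mu> (\<lambda>x. (h x)\<^sup>2 - 2 * h y * h x + (h y)\<^sup>2)"
      using h2 bm_integrable[OF h] by simp
    show "integrable \<mu> (\<lambda>x. (\<Sum>i\<in>UNIV. (v i)\<^sup>2) * (\<Sum>i\<in>UNIV. (dist (x i) (y i))\<^sup>2))"
      using d by simp
    fix x
    have "(h x)\<^sup>2 - 2 * h y * h x + (h y)\<^sup>2 = \<bar>h x - h y\<bar>\<^sup>2"
      by (simp add: power2_eq_square algebra_simps)
    also have "\<dots> \<le> (\<Sum>i\<in>UNIV. v i * dist (x i) (y i))\<^sup>2"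
      by (intro power_mono coord_lipschitz_sum_bound lip) simp
    also have "\<dots> \<le> (\<Sum>i\<in>UNIV. (v i)\<^sup>2) * (\<Sum>i\<in>UNIV. (dist (x i) (y i))\<^sup>2)"
      by (rule Cauchy_Schwarz_ineq_sum)
    finally show "(h x)\<^sup>2 - 2 * h y * h x + (h y)\<^sup>2 \<le> \<dots>" .
  qed
  also have "\<dots> = (\<Sum>i\<in>UNIV. (v i)\<^sup>2) * (\<Sum>i\<in>UNIV. \<integral>x. (dist (x i) (y i))\<^sup>2 \<partial>\<mu>)"
    using d by simp
  finally show ?thesis .
qed

lemma dobrushin_iterate_bound:
  fixes s :: real
  assumes s: "s > (real CARD('i) - 1 + spectral_radius (dobrushin_matrix \<kappa>)) / CARD('i)"
  obtains K where "\<And>k j. \<bar>(dobrushin_step ^^ k) u j\<bar> \<le> K * s ^ k"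
proof -
  define n where "n = CARD('i)"
  have n: "n > 0" by (simp add: n_def)
  have C: "dobrushin_matrix \<kappa> \<in> carrier_mat n n" by (simp add: dobrushin_matrix_def n_def)
  let ?a = "(real n - 1) / n" and ?b = "1 / real n"
  have a: "?a \<ge> 0" and b: "?b > 0" using n by auto
  have "spectral_radius (dobrushin_matrix \<kappa>) \<ge> 0" using spectral_radius_mem_max(1)[OF C n] by auto
  then have s0: "s > 0"
    using s n unfolding n_def[symmetric]
    by (smt (verit) divide_nonneg_nonneg of_nat_0_le_iff of_nat_1 of_nat_le_iff Suc_leI One_nat_def)
  have "?a + ?b * spectral_radius (dobrushin_matrix \<kappa>) < s"
    using s by (simp add: n_def add_divide_distrib)
  then obtain K where K: "\<And>k. norm_bound
    ((complex_of_real (?a / s) \<cdot>\<^sub>m 1\<^sub>m n + complex_of_real (?b / s) \<cdot>\<^sub>m dobrushin_matrix \<kappa>) ^\<^sub>m k) K"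
    using affine_power_bound[OF C n a b] by blast
  define M where "M i j = (if i = j then ?a else 0) + ?b * c i j" for i j
  have "norm_bound (mat n n (\<lambda>(i, j). complex_of_real
    (M (from_nat_into UNIV i) (from_nat_into UNIV j) / s)) ^\<^sub>m k) K" for k
  proof -
    have "(\<lambda>(i, j). complex_of_real (M (from_nat_into UNIV i) (from_nat_into UNIV j) / s)) =
      (\<lambda>(k, l). complex_of_real ((if from_nat_into UNIV k = (from_nat_into UNIV l :: 'i) then ?a / s else 0)
        + ?b / s * c (from_nat_into UNIV k) (from_nat_into UNIV l)))"
      by (auto simp: M_def add_divide_distrib fun_eq_iff)
    then show ?thesis using K[of k] unfolding n_def dobrushin_matrix_affine by simp
  qed
  moreover have "bij_betw (from_nat_into UNIV) {..<n} (UNIV :: 'i set)"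
    unfolding n_def by (rule bij_betw_from_nat_into_finite) simp
  moreover have "(dobrushin_step ^^ Suc k) u j = (\<Sum>i\<in>UNIV. (dobrushin_step ^^ k) u i * M i j)" for k j
  proof -
    let ?v = "(dobrushin_step ^^ k) u"
    have "(\<Sum>i\<in>UNIV. ?v i * M i j) = (\<Sum>i\<in>UNIV. (if i = j then ?v i * ?a else 0) + ?b * (c i j * ?v i))"
      by (intro sum.cong refl) (auto simp: M_def algebra_simps)
    also have "\<dots> = ?v j * ?a + ?b * (\<Sum>i\<in>UNIV. c i j * ?v i)"
      by (simp add: sum.distrib sum_distrib_left)
    also have "\<dots> = dobrushin_step ?v j"
      by (simp add: dobrushin_step_def n_def add_divide_distrib mult.commute)
    finally show ?thesis by simp
  qed
  ultimately have "\<bar>(dobrushin_step ^^ k) u j\<bar> \<le> K * (\<Sum>i\<in>UNIV. \<bar>u i\<bar>) * s ^ k" for k j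
    using linear_recursion_bound[where e="from_nat_into UNIV" and n=n and s=s and M=M and K=K
        and u="\<lambda>k. (dobrushin_step ^^ k) u"] s0 by simp
  then show ?thesis by (rule that)
qed

lemma gibbs_iterate:
  assumes fin: "\<And>i j. dobrushin_coeff \<kappa> i j < \<infinity>"
    and f: "f \<in> bm" and lip: "coord_lipschitz u f" and u: "\<And>i. u i \<ge> 0"
  shows "(gibbs_step ^^ k) f \<in> bm" "coord_lipschitz ((dobrushin_step ^^ k) u) ((gibbs_step ^^ k) f)"
    "(\<integral>x. (gibbs_step ^^ k) f x \<partial>\<mu>) = (\<integral>x. f x \<partial>\<mu>)"
proof -
  have "(gibbs_step ^^ k) f \<in> bm \<and> coord_lipschitz ((dobrushin_step ^^ k) u) ((gibbs_step ^^ k) f) \<and>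
    (\<forall>i. (dobrushin_step ^^ k) u i \<ge> 0) \<and> (\<integral>x. (gibbs_step ^^ k) f x \<partial>\<mu>) = (\<integral>x. f x \<partial>\<mu>)"
    by (induction k) (auto simp: f lip u gibbs_step_bm gibbs_step_coord_lipschitz[OF fin]
        dobrushin_step_nonneg gibbs_step_integral)
  then show "(gibbs_step ^^ k) f \<in> bm" "coord_lipschitz ((dobrushin_step ^^ k) u) ((gibbs_step ^^ k) f)"
    "(\<integral>x. (gibbs_step ^^ k) f x \<partial>\<mu>) = (\<integral>x. f x \<partial>\<mu>)" by auto
qed

lemma gibbs_step_spectral_gap:
  assumes fin: "\<And>i j. dobrushin_coeff \<kappa> i j < \<infinity>"
    and y: "\<And>i. (\<integral>\<^sup>+ x. ennreal ((dist (x i) (y i))\<^sup>2) \<partial>\<mu>) < \<infinity>"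
    and f: "f \<in> bm" and mean: "(\<integral>x. f x \<partial>\<mu>) = 0"
    and lip: "coord_lipschitz u f" and u: "\<And>i. u i \<ge> 0"
  shows "(\<integral>x. f x * gibbs_step f x \<partial>\<mu>) \<le>
    (real CARD('i) - 1 + spectral_radius (dobrushin_matrix \<kappa>)) / CARD('i) * (\<integral>x. (f x)\<^sup>2 \<partial>\<mu>)"
proof (rule le_of_forall_gt)
  show "0 \<le> (\<integral>x. (f x)\<^sup>2 \<partial>\<mu>)" by simp
  fix s :: real
  assume s: "s > (real CARD('i) - 1 + spectral_radius (dobrushin_matrix \<kappa>)) / CARD('i)"
  note it = gibbs_iterate[OF fin f lip u]
  have C: "dobrushin_matrix \<kappa> \<in> carrier_mat CARD('i) CARD('i)" by (simp add: dobrushin_matrix_def)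
  have "spectral_radius (dobrushin_matrix \<kappa>) \<ge> 0" using spectral_radius_mem_max(1)[OF C] by auto
  moreover have "real CARD('i) \<ge> 1" by (simp add: Suc_le_eq)
  ultimately have "(real CARD('i) - 1 + spectral_radius (dobrushin_matrix \<kappa>)) / CARD('i) \<ge> 0" by simp
  with s have s0: "s > 0" by linarith
  define b where "b k = (\<integral>x. ((gibbs_step ^^ k) f x)\<^sup>2 \<partial>\<mu>)" for k
  \<comment> \<open>Self-adjointness moves one step from one factor to the other: the squared norm
    of the iterate k + 1 is the inner product of the iterates k and k + 2, to which Cauchy-Schwarz
    applies.\<close>
  have convex: "(b (Suc k))\<^sup>2 \<le> b k * b (Suc (Suc k))" for k
  proof -
    have "b (Suc k) = (\<integral>x. gibbs_step ((gibbs_step ^^ k) f) x * (gibbs_step ^^ Suc k) f x \<partial>\<mu>)"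
      by (simp add: b_def power2_eq_square)
    also have "\<dots> = (\<integral>x. (gibbs_step ^^ k) f x * (gibbs_step ^^ Suc (Suc k)) f x \<partial>\<mu>)"
      unfolding gibbs_step_symmetric[OF it(1) it(1)] by simp
    finally show ?thesis
      unfolding b_def using integral_cauchy_schwarz[OF it(1) it(1), of k "Suc (Suc k)"] by simp
  qed
  obtain K where K: "\<And>k j. \<bar>(dobrushin_step ^^ k) u j\<bar> \<le> K * s ^ k"
    using dobrushin_iterate_bound[OF s] by blast
  define D where "D = (\<Sum>i\<in>UNIV. \<integral>x. (dist (x i) (y i))\<^sup>2 \<partial>\<mu>)"
  have D: "D \<ge> 0" unfolding D_def by (intro sum_nonneg) simp
  \<comment> \<open>The constant in front of the geometric bound depends on f through K and on \<mu>
    through D; neither survives in the conclusion.\<close>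
  have "b 1 \<le> s\<^sup>2 * b 0"
  proof (rule log_convex_decay)
    show "b k \<ge> 0" for k by (simp add: b_def)
    show "b k \<le> (real CARD('i) * K\<^sup>2 * D) * (s\<^sup>2) ^ k" for k
    proof -
      have "b k \<le> (\<Sum>i\<in>UNIV. ((dobrushin_step ^^ k) u i)\<^sup>2) * D"
        unfolding b_def D_def using it(3) mean by (intro second_moment_bound[OF y it(1) _ it(2)]) simp
      also have "\<dots> \<le> (\<Sum>i\<in>(UNIV::'i set). (K * s ^ k)\<^sup>2) * D"
      proof (intro mult_right_mono D sum_mono)
        fix i
        have "((dobrushin_step ^^ k) u i)\<^sup>2 = \<bar>(dobrushin_step ^^ k) u i\<bar>\<^sup>2" by simp
        also have "\<dots> \<le> (K * s ^ k)\<^sup>2" by (intro power_mono K) simp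
        finally show "((dobrushin_step ^^ k) u i)\<^sup>2 \<le> (K * s ^ k)\<^sup>2" .
      qed
      also have "\<dots> = (real CARD('i) * K\<^sup>2 * D) * (s\<^sup>2) ^ k"
        by (simp add: power_mult_distrib power_mult[symmetric] mult.commute)
      finally show ?thesis .
    qed
  qed (use convex s0 in auto)
  \<comment> \<open>Cauchy-Schwarz converts the contraction of the norm, with factor s, into the
    bound on the quadratic form.\<close>
  have "(\<integral>x. f x * gibbs_step f x \<partial>\<mu>)\<^sup>2 \<le> b 0 * b 1"
    using integral_cauchy_schwarz[OF it(1) it(1), of 0 1] by (simp add: b_def)
  also have "\<dots> \<le> b 0 * (s\<^sup>2 * b 0)"
    by (intro mult_left_mono \<open>b 1 \<le> s\<^sup>2 * b 0\<close>) (simp add: b_def)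
  also have "\<dots> = (s * b 0)\<^sup>2" by (simp add: power2_eq_square)
  finally have "(\<integral>x. f x * gibbs_step f x \<partial>\<mu>) \<le> s * b 0"
    by (rule power2_le_imp_le) (use s0 in \<open>simp add: b_def\<close>)
  then show "(\<integral>x. f x * gibbs_step f x \<partial>\<mu>) \<le> s * (\<integral>x. (f x)\<^sup>2 \<partial>\<mu>)" by (simp add: b_def)
qed

lemma cond_covar_bm: "f \<in> bm \<Longrightarrow> cond_covar \<kappa> i f f \<in> bm"
  unfolding cond_covar_def[abs_def] by (intro bm_diff bm_mult cond_int_bm)

lemma integral_cond_covar:
  assumes f: "f \<in> bm"
  shows "(\<integral>x. cond_covar \<kappa> i f f x \<partial>\<mu>) = (\<integral>x. (f x)\<^sup>2 \<partial>\<mu>) - (\<integral>x. cond_int \<kappa> i f x * f x \<partial>\<mu>)"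
  unfolding cond_covar_def cond_int_projection[OF f f] using f
  by (simp add: integral_cond_int bm_mult bm_integrable cond_int_bm power2_eq_square)

text \<open>If no kernel depends on x, the matrix vanishes and this is the Efron-Stein inequality
  for product measures. The sum on the right is n V minus n times the quadratic form of
  \<open>gibbs_step\<close>, where V is the variance of f, and the gap leaves n V - (n - 1 + r)
  V.\<close>

lemma efron_stein_spectral_gap:
  assumes fin: "\<And>i j. dobrushin_coeff \<kappa> i j < \<infinity>"
    and y: "\<And>i. (\<integral>\<^sup>+ x. ennreal ((dist (x i) (y i))\<^sup>2) \<partial>\<mu>) < \<infinity>"
    and f: "f \<in> bm" and lip: "coord_lipschitz u f" and u: "\<And>i. u i \<ge> 0"
  shows "(1 - spectral_radius (dobrushin_matrix \<kappa>)) * covar \<mu> f f \<le>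
    (\<Sum>i\<in>UNIV. \<integral>x. cond_covar \<kappa> i f f x \<partial>\<mu>)"
proof -
  define n where "n = real CARD('i)"
  have n: "n > 0" by (simp add: n_def)
  define r where "r = spectral_radius (dobrushin_matrix \<kappa>)"
  define m where "m = (\<integral>x. f x \<partial>\<mu>)"
  define h where "h x = f x - m" for x
  have h: "h \<in> bm" unfolding h_def[abs_def] by (intro bm_diff f bm_const)
  have hm: "(\<integral>x. h x \<partial>\<mu>) = 0"
    using bm_integrable[OF f] by (simp add: h_def m_def)
  have hl: "coord_lipschitz u h" using lip by (simp add: coord_lipschitz_def h_def)
  have f2: "integrable \<mu> (\<lambda>x. (f x)\<^sup>2)" unfolding power2_eq_square by (intro bm_integrable bm_mult f)
  have covar: "covar \<mu> f f = (\<integral>x. (h x)\<^sup>2 \<partial>\<mu>)"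
  proof -
    have "(\<integral>x. (h x)\<^sup>2 \<partial>\<mu>) = (\<integral>x. (f x)\<^sup>2 - 2 * m * f x + m\<^sup>2 \<partial>\<mu>)"
      by (simp add: h_def power2_eq_square algebra_simps)
    also have "\<dots> = (\<integral>x. (f x)\<^sup>2 \<partial>\<mu>) - 2 * m * m + m\<^sup>2"
      using f2 bm_integrable[OF f] by (simp add: m_def)
    finally show ?thesis by (simp add: covar_def m_def power2_eq_square)
  qed
  \<comment> \<open>The spectral gap holds for centred functions; subtracting the mean leaves
    conditional variances unchanged.\<close>
  have cc: "cond_covar \<kappa> i f f x = cond_covar \<kappa> i h h x" for i x
  proof -
    interpret \<kappa>: prob_space "\<kappa> i x" by (rule kernel_prob)
    have i1: "integrable (\<kappa> i x) (\<lambda>z. f (x(i := z)))" by (rule bm_slice_integrable[OF f])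
    have i2: "integrable (\<kappa> i x) (\<lambda>z. f (x(i := z)) * f (x(i := z)))"
      by (rule bm_slice_integrable[OF bm_mult[OF f f]])
    have e1: "cond_int \<kappa> i h x = cond_int \<kappa> i f x - m"
      using i1 \<kappa>.prob_space by (simp add: cond_int_def h_def)
    have "cond_int \<kappa> i (\<lambda>y. h y * h y) x =
      (\<integral>z. f (x(i := z)) * f (x(i := z)) - 2 * m * f (x(i := z)) + m\<^sup>2 \<partial>\<kappa> i x)"
      by (simp add: cond_int_def h_def power2_eq_square algebra_simps)
    then have e2: "cond_int \<kappa> i (\<lambda>y. h y * h y) x =
      cond_int \<kappa> i (\<lambda>y. f y * f y) x - 2 * m * cond_int \<kappa> i f x + m\<^sup>2"
      using i1 i2 \<kappa>.prob_space by (simp add: cond_int_def)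
    show ?thesis unfolding cond_covar_def e1 e2 by (simp add: power2_eq_square algebra_simps)
  qed
  define V where "V = (\<integral>x. (h x)\<^sup>2 \<partial>\<mu>)"
  have "(\<integral>x. h x * gibbs_step h x \<partial>\<mu>) = (\<Sum>i\<in>UNIV. \<integral>x. cond_int \<kappa> i h x * h x \<partial>\<mu>) / n"
    using gibbs_step_integral_mult[OF h h] by (simp add: n_def mult.commute)
  then have "(\<Sum>i\<in>UNIV. \<integral>x. cond_int \<kappa> i h x * h x \<partial>\<mu>) / n \<le> (n - 1 + r) / n * V"
    using gibbs_step_spectral_gap[OF fin y h hm hl u] by (simp add: n_def r_def V_def)
  then have "(\<Sum>i\<in>UNIV. \<integral>x. cond_int \<kappa> i h x * h x \<partial>\<mu>) \<le> (n - 1 + r) * V"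
    using n by (simp add: field_simps)
  moreover have "(\<Sum>i\<in>UNIV. \<integral>x. cond_covar \<kappa> i f f x \<partial>\<mu>) = n * V - (\<Sum>i\<in>UNIV. \<integral>x. cond_int \<kappa> i h x * h x \<partial>\<mu>)"
    unfolding cc integral_cond_covar[OF h] by (simp add: sum_subtractf n_def V_def)
  ultimately show ?thesis
    unfolding covar r_def[symmetric] V_def[symmetric] by (simp add: algebra_simps)
qed

end

theorem theorem2p2:
  fixes A :: "('e::polish_space, 'b::euclidean_space) chart set"
    and g :: "('e, 'b) metric_tensor"
    and \<mu> :: "('i::finite \<Rightarrow> 'e) measure"
    and \<kappa> :: "'i \<Rightarrow> ('i \<Rightarrow> 'e) \<Rightarrow> 'e measure"
  assumes "complete_connected_riemannian_manifold A g"
    and "prob_space \<mu>" and "sets \<mu> = sets (\<Pi>\<^sub>M i\<in>UNIV. borel)"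
    and "regular_conditional_distributions \<mu> \<kappa>"
    and "\<exists>y. \<forall>i. (\<integral>\<^sup>+ x. ennreal ((dist (x i) (y i))\<^sup>2) \<partial>\<mu>) < \<infinity>"
    and "\<forall>i j. dobrushin_coeff \<kappa> i j < \<infinity>"
    and "spectral_radius (dobrushin_matrix \<kappa>) < 1"
    and "lambda0 A g \<kappa> > 0"
  shows "(\<forall>f\<in>Cb1 A g.
            lambda0 A g \<kappa> * ereal (1 - spectral_radius (dobrushin_matrix \<kappa>)) * ereal (covar \<mu> f f)
              \<le> ereal (\<integral>x. (\<Sum>i\<in>UNIV. (partial_grad_norm A g i f x)\<^sup>2) \<partial>\<mu>)) \<and>
         lambda1 A g \<mu> \<ge> lambda0 A g \<kappa> * ereal (1 - spectral_radius (dobrushin_matrix \<kappa>))"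
proof -
  interpret gibbs \<mu> \<kappa>
    using assms(2-4) by (simp add: gibbs_def gibbs_axioms_def)
  have A: "smooth_atlas A" and g: "riemannian_metric A g"
    using assms(1) unfolding complete_connected_riemannian_manifold_def by auto
  have fin: "dobrushin_coeff \<kappa> i j < \<infinity>" for i j using assms(6) by blast
  obtain y where y: "\<And>i. (\<integral>\<^sup>+ x. ennreal ((dist (x i) (y i))\<^sup>2) \<partial>\<mu>) < \<infinity>" using assms(5) by blast
  define r where "r = spectral_radius (dobrushin_matrix \<kappa>)"
  have r: "1 - r > 0" using assms(7) by (simp add: r_def)
  define L where "L = {l. 0 \<le> l \<and> (\<forall>x. \<forall>i. \<forall>f\<in>Cb1 A g.
     l * cond_covar \<kappa> i f f x \<le> cond_int \<kappa> i (\<lambda>y. (partial_grad_norm A g i f y)\<^sup>2) x)}"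
  have lambda0: "lambda0 A g \<kappa> = (SUP l\<in>L. ereal l)" by (simp add: lambda0_def L_def)
  \<comment> \<open>The supremum of the empty set is minus infinity, which contradicts positivity of
    \<open>lambda0\<close>.\<close>
  have "L \<noteq> {}" using assms(8) unfolding lambda0 by (auto simp: bot_ereal_def)
  have key: "l * (1 - r) * covar \<mu> f f \<le> (\<integral>x. (\<Sum>i\<in>UNIV. (partial_grad_norm A g i f x)\<^sup>2) \<partial>\<mu>)"
    and covar_nonneg: "covar \<mu> f f \<ge> 0"
    if l: "l \<in> L" and f: "f \<in> Cb1 A g" for l f
  proof -
    obtain u where u: "\<And>i. u i \<ge> 0"
      and "\<And>x i z z'. \<bar>f (x(i := z)) - f (x(i := z'))\<bar> \<le> u i * dist z z'"
      using Cb1_coordinate_lipschitz[OF assms(1) f] by blast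
    then have lip: "coord_lipschitz u f" unfolding coord_lipschitz_def by blast
    \<comment> \<open>Continuity gives measurability for the Borel sets of the product topology; by
      second countability these form the product sigma-algebra.\<close>
    have fm: "f \<in> borel_measurable P"
      using borel_measurable_continuous_onI[OF coord_lipschitz_continuous[OF lip]]
      by (simp add: measurable_cong_sets[OF sets_PiM_equal_borel refl])
    have C1: "C1_product A f" and "bounded (range f)"
      and gb: "bounded (range (partial_grad_norm A g i f))" for i
      using f by (auto simp: Cb1_def)
    then obtain K where "\<And>x. \<bar>f x\<bar> \<le> K" unfolding bounded_iff by auto
    then have fb: "f \<in> bm" using fm by (rule bmI[rotated])
    have d: "chart_differentiable A (\<lambda>z. f (x(i := z))) p" for x i p
      by (rule C1_product_chart_differentiable[OF A C1])
    \<comment> \<open>Without measurability the Bochner integral of the squared norm would be 0 by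
      convention, and neither monotonicity nor invariance under resampling could be applied to
      it.\<close>
    have grad: "(\<lambda>x. (partial_grad_norm A g i f x)\<^sup>2) \<in> bm" for i
    proof -
      obtain K where K: "\<And>x. \<bar>partial_grad_norm A g i f x\<bar> \<le> K"
        using gb[of i] unfolding bounded_iff by auto
      have "\<bar>(partial_grad_norm A g i f x)\<^sup>2\<bar> \<le> K\<^sup>2" for x
        using power_mono[OF K, of x 2] by simp
      then show ?thesis by (rule bmI[OF partial_grad_norm_sqr_measurable[OF A g fm d]])
    qed
    show "covar \<mu> f f \<ge> 0"
      using integral_cauchy_schwarz[OF fb bm_const[of 1]]
      by (simp add: covar_def power2_eq_square)
    have "l * (1 - r) * covar \<mu> f f \<le> l * (\<Sum>i\<in>UNIV. \<integral>x. cond_covar \<kappa> i f f x \<partial>\<mu>)"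
      using efron_stein_spectral_gap[OF fin y fb lip u] l
      unfolding mult.assoc r_def L_def by (intro mult_left_mono) auto
    also have "\<dots> = (\<Sum>i\<in>UNIV. \<integral>x. l * cond_covar \<kappa> i f f x \<partial>\<mu>)"
      by (simp add: sum_distrib_left)
    also have "\<dots> \<le> (\<Sum>i\<in>UNIV. \<integral>x. cond_int \<kappa> i (\<lambda>y. (partial_grad_norm A g i f y)\<^sup>2) x \<partial>\<mu>)"
    proof (intro sum_mono integral_mono bm_integrable cond_int_bm grad)
      show "(\<lambda>x. l * cond_covar \<kappa> i f f x) \<in> bm" for i
        by (intro bm_mult bm_const cond_covar_bm fb)
      show "l * cond_covar \<kappa> i f f x \<le> cond_int \<kappa> i (\<lambda>y. (partial_grad_norm A g i f y)\<^sup>2) x" for i x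
        using l f unfolding L_def by blast
    qed
    also have "\<dots> = (\<integral>x. (\<Sum>i\<in>UNIV. (partial_grad_norm A g i f x)\<^sup>2) \<partial>\<mu>)"
      using grad by (simp add: integral_cond_int bm_integrable)
    finally show "l * (1 - r) * covar \<mu> f f \<le> (\<integral>x. (\<Sum>i\<in>UNIV. (partial_grad_norm A g i f x)\<^sup>2) \<partial>\<mu>)" .
  qed
  \<comment> \<open>Multiplication by a nonnegative real commutes with the supremum over a nonempty
    set of nonnegative reals. This also covers infinite \<open>lambda0\<close>, including c = 0,
    where both sides are 0.\<close>
  have scale: "lambda0 A g \<kappa> * ereal c = (SUP l\<in>L. ereal (l * c))" if "c \<ge> 0" for c
    unfolding lambda0 using SUP_ereal_mult_left[OF \<open>L \<noteq> {}\<close>, of ereal "ereal c"] that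
    by (simp add: L_def mult.commute)
  have "lambda0 A g \<kappa> * ereal (1 - r) * ereal (covar \<mu> f f)
    \<le> ereal (\<integral>x. (\<Sum>i\<in>UNIV. (partial_grad_norm A g i f x)\<^sup>2) \<partial>\<mu>)" if f: "f \<in> Cb1 A g" for f
  proof -
    have "covar \<mu> f f \<ge> 0" using covar_nonneg f \<open>L \<noteq> {}\<close> by blast
    then have "lambda0 A g \<kappa> * ereal ((1 - r) * covar \<mu> f f) = (SUP l\<in>L. ereal (l * ((1 - r) * covar \<mu> f f)))"
      using r by (intro scale) simp
    also have "\<dots> \<le> ereal (\<integral>x. (\<Sum>i\<in>UNIV. (partial_grad_norm A g i f x)\<^sup>2) \<partial>\<mu>)"
      using key[OF _ f] by (intro SUP_least) (simp add: mult.assoc)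
    finally show ?thesis by (simp add: mult.assoc)
  qed
  moreover have "lambda0 A g \<kappa> * ereal (1 - r) \<le> lambda1 A g \<mu>"
    unfolding scale[OF less_imp_le[OF r]] lambda1_def
  proof (rule SUP_least, rule Sup_upper, rule imageI)
    fix l assume l: "l \<in> L"
    then show "l * (1 - r) \<in> {l. 0 \<le> l \<and> (\<forall>f\<in>Cb1 A g.
      l * covar \<mu> f f \<le> (\<integral>x. (\<Sum>i\<in>UNIV. (partial_grad_norm A g i f x)\<^sup>2) \<partial>\<mu>))}"
      using key[OF l] r by (simp add: L_def)
  qed
  ultimately show ?thesis unfolding r_def by blast
qed

end
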